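(* Let $k\ge 6$ be an integer and let $m=3k+2$. Let $G$ be a connected $\{\theta(1,2,2),\theta(1,2,3)\}$-free graph of size $m$ with no pendant vertices. Then $q(G)\le q'(m)$, where $q'(m)$ is the largest root of $$x^4-\tfrac23(m+10)x^3+\tfrac23(7m+16)x^2-(10m-7)x+\tfrac43(5m-16)=0.$$ Moreover, equality $q(G)=q'(m)$ holds if and only if $G\cong H^{(5)}_{\frac{2m-7}{3}}$.
   Context: All graphs are finite, simple, undirected and connected. The size of a graph is its number of edges. A pendant vertex is a vertex of degree $1$. A graph is $\mathcal F$-free if it contains no member of the family $\mathcal F$ as a (not necessarily induced) subgraph. $q(G)$ denotes the signless Laplacian spectral radius of $G$, i.e. the largest eigenvalue of $Q(G)=D(G)+A(G)$, where $A(G)$ is the adjacency matrix and $D(G)$ the diagonal matrix of vertex degrees. The theta graph $\theta(l_1,\dots,l_k)$ consists of $k\ge 3$ internally disjoint paths of lengths (numbers of edges) $l_1,\dots,l_k$, all joining the same two distinct end vertices. For odd $p\ge5$, the friendship graph $F_p$ of order $p$ consists of $\frac{p-1}{2}$ triangles having precisely one vertex (the central vertex) common to all of them. For odd $p\ge 5$ and $r\ge 4$, the graph $H_p^{(r)}$, of order $p+r-1$, is obtained from $F_p$ by identifying the central vertex of $F_p$ with a vertex of the cycle $C_r$ on $r$ vertices. *)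

theory Defs
  imports
    "HOL-Library.Countable_Set"
    "Graph_Theory.Digraph_Component"
    "Graph_Theory.Digraph_Isomorphism"
    "Jordan_Normal_Form.Spectral_Radius"
begin

text \<open>
  A finite simple undirected graph is, as in the library, a \<^locale>\<open>pair_graph\<close>: a finite,
  loop-free, symmetric digraph whose arcs are pairs of vertices. Every undirected edge
  \<open>uv\<close> is represented by the two arcs \<open>(u, v)\<close> and \<open>(v, u)\<close>. Since arcs are symmetric, the degree
  of a vertex is its \<^const>\<open>out_degree\<close>.
\<close>

definition edges :: "'a pair_pre_digraph \<Rightarrow> 'a set set" where
  "edges G = {{u, v} | u v. (u, v) \<in> parcs G}"

definition size_of :: "'a pair_pre_digraph \<Rightarrow> nat" where
  "size_of G = card (edges G)"

definition degree_of :: "'a pair_pre_digraph \<Rightarrow> 'a \<Rightarrow> nat" where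
  "degree_of G v = out_degree (with_proj G) v"

definition pendant :: "'a pair_pre_digraph \<Rightarrow> 'a \<Rightarrow> bool" where
  "pendant G v \<longleftrightarrow> v \<in> pverts G \<and> degree_of G v = 1"

definition is_connected :: "'a pair_pre_digraph \<Rightarrow> bool" where
  "is_connected G \<longleftrightarrow> Digraph_Component.connected (with_proj G)"

definition isomorphic :: "'a pair_pre_digraph \<Rightarrow> 'b pair_pre_digraph \<Rightarrow> bool" where
  "isomorphic G H \<longleftrightarrow> digraph_iso (with_proj G) (with_proj H)"

definition contains :: "'a pair_pre_digraph \<Rightarrow> 'b pair_pre_digraph \<Rightarrow> bool" where
  "contains G F \<longleftrightarrow> (\<exists>H. subgraph (with_proj H) (with_proj G) \<and> isomorphic F H)"

definition family_free :: "'b pair_pre_digraph set \<Rightarrow> 'a pair_pre_digraph \<Rightarrow> bool" where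
  "family_free \<F> G \<longleftrightarrow> (\<forall>F\<in>\<F>. \<not> contains G F)"

text \<open>
  The rows and columns of the matrices follow the enumeration
  \<^term>\<open>from_nat_into (pverts G)\<close>, a bijection from \<open>{..<card (pverts G)}\<close> onto the finite
  vertex set. Another enumeration would give a permutation-similar matrix, with the same spectrum.
\<close>

definition adjacency_mat :: "'a pair_pre_digraph \<Rightarrow> real mat" where
  "adjacency_mat G = mat (card (pverts G)) (card (pverts G))
     (\<lambda>(i, j). if (from_nat_into (pverts G) i, from_nat_into (pverts G) j) \<in> parcs G
               then 1 else 0)"

definition degree_mat :: "'a pair_pre_digraph \<Rightarrow> real mat" where
  "degree_mat G = mat (card (pverts G)) (card (pverts G))
     (\<lambda>(i, j). if i = j then real (degree_of G (from_nat_into (pverts G) i)) else 0)"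

definition signless_laplacian :: "'a pair_pre_digraph \<Rightarrow> real mat" where
  "signless_laplacian G = degree_mat G + adjacency_mat G"

definition q_radius :: "'a pair_pre_digraph \<Rightarrow> real" where
  "q_radius G = Max (spectrum (signless_laplacian G))"

text \<open>
  The graph \<open>\<theta>(l\<^sub>1, \<dots>, l\<^sub>k)\<close> of a list of positive lengths of which at most one is \<open>1\<close> (otherwise
  parallel edges would be merged). The \<open>j\<close>-th vertex of the \<open>i\<close>-th path is the common end \<open>(0, 0)\<close>
  for \<open>j = 0\<close>, the common end \<open>(0, 1)\<close> for \<open>j = l\<^sub>i\<close>, and a vertex of its own in between.
  \<^const>\<open>mk_symmetric\<close> adds the reverse of every arc.
\<close>

definition theta_vertex :: "nat list \<Rightarrow> nat \<Rightarrow> nat \<Rightarrow> nat \<times> nat" where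
  "theta_vertex ls i j =
     (if j = 0 then (0, 0) else if j = ls ! i then (0, 1) else (Suc i, j))"

definition theta_graph :: "nat list \<Rightarrow> (nat \<times> nat) pair_pre_digraph" where
  "theta_graph ls = mk_symmetric (with_proj
     \<lparr> pverts = {theta_vertex ls i j | i j. i < length ls \<and> j \<le> ls ! i},
       parcs = {(theta_vertex ls i j, theta_vertex ls i (Suc j)) | i j.
                  i < length ls \<and> j < ls ! i} \<rparr>)"

text \<open>For odd \<open>p\<close>; the central vertex is \<open>0\<close>.\<close>

definition friendship_graph :: "nat \<Rightarrow> nat pair_pre_digraph" where
  "friendship_graph p = mk_symmetric (with_proj
     \<lparr> pverts = {..<p},
       parcs = (\<Union>i\<in>{1..(p - 1) div 2}. {(0, 2 * i - 1), (0, 2 * i), (2 * i - 1, 2 * i)}) \<rparr>)"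

definition cycle_graph :: "nat \<Rightarrow> nat pair_pre_digraph" where
  "cycle_graph r = mk_symmetric (with_proj
     \<lparr> pverts = {..<r}, parcs = {(i, Suc i mod r) | i. i < r} \<rparr>)"

text \<open>
  The graph \<open>H\<^sub>p\<^sup>(\<^sup>r\<^sup>)\<close>: the vertices \<open>1, \<dots>, r - 1\<close> of the cycle are renamed to
  \<open>p, \<dots>, p + r - 2\<close>, so that the two graphs share exactly the central vertex \<open>0\<close>.
\<close>

definition H_vertex :: "nat \<Rightarrow> nat \<Rightarrow> nat" where
  "H_vertex p j = (if j = 0 then 0 else p + j - 1)"

definition H_graph :: "nat \<Rightarrow> nat \<Rightarrow> nat pair_pre_digraph" where
  "H_graph p r =
     \<lparr> pverts = pverts (friendship_graph p) \<union> H_vertex p ` pverts (cycle_graph r),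
       parcs = parcs (friendship_graph p)
         \<union> map_prod (H_vertex p) (H_vertex p) ` parcs (cycle_graph r) \<rparr>"

definition q_bound :: "nat \<Rightarrow> real" where
  "q_bound m = Max {x :: real.
     x ^ 4 - 2 / 3 * (real m + 10) * x ^ 3 + 2 / 3 * (7 * real m + 16) * x\<^sup>2
       - (10 * real m - 7) * x + 4 / 3 * (5 * real m - 16) = 0}"

end

(*
  Fix a vertex v of degree d and split the other vertices into the neighbours of v and the far
  vertices. Without theta(1,2,2) the neighbours induce a matching, of t edges say, and without
  theta(1,2,3) a far vertex adjacent to a matched neighbour has no other neighbour next to v. With
  minimum degree 2, counting the 3k+2 edges gives d <= 2k and leaves few possibilities for large d.
  By the Collatz-Wielandt principle, a positive vector x with Qx < Lx forces q(G) < L. The degree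
  vector works for a rational L slightly below q'(m) unless some v has d = 2k and t = k-1, which
  is the extremal graph, or the far vertices are independent and (d, t) is (2k, k-2) or
  (2k-1, k-2); in these two cases a vector concentrated at v works. For the extremal graph a
  positive eigenvector for q'(m) is explicit.
*)

theory Submission
  imports Defs
begin

text \<open>The count is a question of price. A triangle at \<open>v\<close> costs three edges and
  supplies two neighbours; a neighbour on no triangle costs at least two edges. So 3k+2 edges pay
  for at most k triangles with two edges left over, and minimum degree 2 leaves no way to place
  those two. Giving up one triangle leaves five edges, which close up to a 5-cycle through
  \<open>v\<close>. The obstacle is precision. At \<open>v\<close> the degree vector gives the
  quotient d + (mean degree of the neighbours), which is 2k+2 at the extremal vertex and also for
  (d, t) = (2k, k-2), while q'(m) is only about 2k+1+1/k. For (2k-1, k-2) it gives 2k+1+2/(2k-1),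
  again slightly too much. Hence the separate vectors, and hence a threshold whose offset from 2k+1
  is itself of order 1/k. Since the threshold is strictly below q'(m), the inequality and the
  equality case are settled together.\<close>

section \<open>Simple graphs and edge counting around a vertex\<close>

locale simple_graph =
  fixes V :: "'a set" and R :: "('a \<times> 'a) set"
  assumes finite_V: "finite V" and R_subset: "R \<subseteq> V \<times> V"
    and sym_R: "sym R" and irrefl_R: "irrefl R"
begin

abbreviation nbrs :: "'a \<Rightarrow> 'a set" where "nbrs v \<equiv> R `` {v}"

abbreviation deg :: "'a \<Rightarrow> nat" where "deg v \<equiv> card (nbrs v)"

lemma finite_R: "finite R"
  using finite_subset[OF R_subset] finite_V by blast

lemma nbrs_subset: "nbrs v \<subseteq> V"
  using R_subset by blast

lemma finite_nbrs [simp]: "finite (nbrs v)"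
  using nbrs_subset finite_V finite_subset by blast

lemma nbr_sym: "(u, v) \<in> R \<Longrightarrow> (v, u) \<in> R"
  using sym_R by (simp add: symD)

lemma nbr_neq: "(u, v) \<in> R \<Longrightarrow> u \<noteq> v"
  using irrefl_R by (auto simp: irrefl_def)

end

text \<open>Every fibre of \<open>(u, v)\<close> to \<open>{u, v}\<close> has exactly two elements:
  symmetry supplies the second and irreflexivity makes it different.\<close>

lemma card_symmetric_rel:
  assumes "finite S" "sym S" "irrefl S"
  shows "card S = 2 * card {{u, v} | u v. (u, v) \<in> S}"
proof -
  let ?f = "\<lambda>(u, v). {u, v}"
  have im: "?f ` S = {{u, v} | u v. (u, v) \<in> S}" by force
  have "card {e \<in> S. ?f e = y} = 2" if "y \<in> ?f ` S" for y
  proof -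
    from that obtain u v where uv: "(u, v) \<in> S" "y = {u, v}" by auto
    have "(v, u) \<in> S" "u \<noteq> v"
      using uv assms by (auto dest: symD simp: irrefl_def)
    then have "{e \<in> S. ?f e = y} = {(u, v), (v, u)}"
      using uv by (auto simp: doubleton_eq_iff)
    then show ?thesis using \<open>u \<noteq> v\<close> by simp
  qed
  then have "(\<Sum>y\<in>?f ` S. card {e \<in> S. ?f e = y}) = (\<Sum>y\<in>?f ` S. 2)"
    by (intro sum.cong) auto
  moreover have "card S = (\<Sum>y\<in>?f ` S. card {e \<in> S. ?f e = y})"
    using sum.image_gen[OF assms(1), of "\<lambda>_. 1::nat" ?f] by simp
  ultimately show ?thesis using im by simp
qed

lemma sum_card_Image:
  assumes "finite S" "finite X" "finite Y"
  shows "(\<Sum>x\<in>X. card (S `` {x} \<inter> Y)) = card (S \<inter> X \<times> Y)"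
proof -
  have "S \<inter> X \<times> Y = Sigma X (\<lambda>x. S `` {x} \<inter> Y)" by auto
  then show ?thesis using assms by (simp add: card_SigmaI)
qed

context simple_graph
begin

lemma sum_card_swap:
  assumes "finite X" "finite Y"
  shows "(\<Sum>x\<in>X. card (nbrs x \<inter> Y)) = (\<Sum>y\<in>Y. card (nbrs y \<inter> X))"
proof -
  have "R \<inter> Y \<times> X = prod.swap ` (R \<inter> X \<times> Y)"
    using nbr_sym by (force simp: image_iff)
  then have "card (R \<inter> Y \<times> X) = card (R \<inter> X \<times> Y)"
    by (simp add: card_image)
  then show ?thesis
    using assms by (simp add: sum_card_Image[OF finite_R])
qed

text \<open>Handshake lemma for the subgraph induced on \<open>X\<close>. It makes the number of
  triangle neighbours even and the halving in \<open>inner\<close> exact.\<close>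

lemma even_sum_card:
  assumes "finite X"
  shows "even (\<Sum>x\<in>X. card (nbrs x \<inter> X))"
proof -
  have "sym (R \<inter> X \<times> X)" "irrefl (R \<inter> X \<times> X)"
    using sym_R irrefl_R by (auto simp: sym_def irrefl_def)
  then show ?thesis
    using card_symmetric_rel[of "R \<inter> X \<times> X"] assms finite_R
    by (simp add: sum_card_Image)
qed

lemma sum_deg: "(\<Sum>v\<in>V. deg v) = 2 * card {{u, v} | u v. (u, v) \<in> R}"
proof -
  have "(\<Sum>v\<in>V. deg v) = (\<Sum>v\<in>V. card (nbrs v \<inter> V))"
    using nbrs_subset by (intro sum.cong) (auto simp: Int_absorb2)
  also have "\<dots> = card (R \<inter> V \<times> V)"
    by (rule sum_card_Image[OF finite_R finite_V finite_V])
  also have "R \<inter> V \<times> V = R" using R_subset by blast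
  finally show ?thesis using card_symmetric_rel[OF finite_R sym_R irrefl_R] by simp
qed

end

text \<open>
  A diamond is \<open>\<theta>(1,2,2)\<close> and a house is \<open>\<theta>(1,2,3)\<close>; in both, \<open>ab\<close> is the path of length one.
\<close>

locale theta_free_graph = simple_graph +
  fixes k :: nat
  assumes k6: "k \<ge> 6"
    and size: "card {{u, v} | u v. (u, v) \<in> R} = 3 * k + 2"
    and min_deg: "v \<in> V \<Longrightarrow> deg v \<ge> 2"
    and no_diamond: "\<lbrakk>(a, b) \<in> R; (a, c) \<in> R; (c, b) \<in> R; (a, d) \<in> R; (d, b) \<in> R\<rbrakk> \<Longrightarrow> c = d"
    and no_house: "\<lbrakk>(a, b) \<in> R; (a, c) \<in> R; (c, b) \<in> R; (a, d) \<in> R; (d, e) \<in> R; (e, b) \<in> R;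
      d \<noteq> b; d \<noteq> c; e \<noteq> a; e \<noteq> c\<rbrakk> \<Longrightarrow> False"
begin

section \<open>Counting around one vertex in the absence of diamonds and houses\<close>

definition triangle_nbrs :: "'a \<Rightarrow> 'a set" where
  "triangle_nbrs v = {u \<in> nbrs v. nbrs u \<inter> nbrs v \<noteq> {}}"

definition far :: "'a \<Rightarrow> 'a set" where
  "far v = V - insert v (nbrs v)"

definition cross :: "'a \<Rightarrow> nat" where
  "cross v = (\<Sum>u\<in>nbrs v. card (nbrs u \<inter> far v))"

lemma finite_far [simp]: "finite (far v)"
  by (simp add: far_def finite_V)

lemma cross_far: "cross v = (\<Sum>w\<in>far v. card (nbrs w \<inter> nbrs v))"
  unfolding cross_def by (rule sum_card_swap) auto

text \<open>Two common neighbours of \<open>u\<close> and \<open>v\<close> would form a diamond on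
  the edge \<open>uv\<close>. This is what makes the edges inside \<open>nbrs v\<close> a
  matching.\<close>

lemma card_nbrs_in_nbrs_le:
  assumes "u \<in> nbrs v" shows "card (nbrs u \<inter> nbrs v) \<le> 1"
proof -
  have "x = y" if "x \<in> nbrs u \<inter> nbrs v" "y \<in> nbrs u \<inter> nbrs v" for x y
    using no_diamond[of v u x y] that assms nbr_sym[of u x] nbr_sym[of u y] by auto
  then show ?thesis using card_le_Suc0_iff_eq[of "nbrs u \<inter> nbrs v"] by auto
qed

lemma card_nbrs_in_nbrs:
  assumes "u \<in> nbrs v"
  shows "card (nbrs u \<inter> nbrs v) = (if u \<in> triangle_nbrs v then 1 else 0)"
proof (cases "nbrs u \<inter> nbrs v = {}")
  case False
  then have "u \<in> triangle_nbrs v" using assms by (simp add: triangle_nbrs_def)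
  moreover have "card (nbrs u \<inter> nbrs v) \<noteq> 0" using False by simp
  with card_nbrs_in_nbrs_le[OF assms] have "card (nbrs u \<inter> nbrs v) = 1" by linarith
  ultimately show ?thesis by simp
qed (use assms in \<open>auto simp: triangle_nbrs_def\<close>)

lemma triangle_nbrs_subset: "triangle_nbrs v \<subseteq> nbrs v"
  by (auto simp: triangle_nbrs_def)

lemma finite_triangle_nbrs [simp]: "finite (triangle_nbrs v)"
  using triangle_nbrs_subset finite_subset by fastforce

lemma sum_triangle: "(\<Sum>u\<in>nbrs v. card (nbrs u \<inter> nbrs v)) = card (triangle_nbrs v)"
proof -
  have "(\<Sum>u\<in>nbrs v. card (nbrs u \<inter> nbrs v))
      = (\<Sum>u\<in>nbrs v. (if u \<in> triangle_nbrs v then 1 else 0))"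
    by (intro sum.cong) (auto simp: card_nbrs_in_nbrs)
  also have "\<dots> = card (nbrs v \<inter> triangle_nbrs v)"
    by (simp add: sum.If_cases Int_def)
  finally show ?thesis using triangle_nbrs_subset by (simp add: Int_absorb1)
qed

lemma even_triangle: "even (card (triangle_nbrs v))"
  using even_sum_card[of "nbrs v"] by (simp add: sum_triangle)

lemma deg_nbr:
  assumes "u \<in> nbrs v"
  shows "deg u = 1 + (if u \<in> triangle_nbrs v then 1 else 0) + card (nbrs u \<inter> far v)"
proof -
  have "{v} \<union> (nbrs u \<inter> nbrs v) \<union> (nbrs u \<inter> far v) = nbrs u"
    using assms nbr_sym[of v u] nbrs_subset by (auto simp: far_def)
  moreover have "card ({v} \<union> (nbrs u \<inter> nbrs v) \<union> (nbrs u \<inter> far v))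
      = card ({v} \<union> (nbrs u \<inter> nbrs v)) + card (nbrs u \<inter> far v)"
    by (rule card_Un_disjoint) (auto simp: far_def)
  moreover have "card ({v} \<union> (nbrs u \<inter> nbrs v)) = card {v} + card (nbrs u \<inter> nbrs v)"
    using nbr_neq[of v v] by (intro card_Un_disjoint) auto
  ultimately show ?thesis using card_nbrs_in_nbrs[OF assms] by simp
qed

lemma deg_far:
  assumes "w \<in> far v"
  shows "deg w = card (nbrs w \<inter> nbrs v) + card (nbrs w \<inter> far v)"
proof -
  have "v \<notin> nbrs w" using assms nbr_sym[of w v] by (auto simp: far_def)
  then have "(nbrs w \<inter> nbrs v) \<union> (nbrs w \<inter> far v) = nbrs w"
    using nbrs_subset by (auto simp: far_def)
  moreover have "card ((nbrs w \<inter> nbrs v) \<union> (nbrs w \<inter> far v))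
      = card (nbrs w \<inter> nbrs v) + card (nbrs w \<inter> far v)"
    by (rule card_Un_disjoint) (auto simp: far_def)
  ultimately show ?thesis by simp
qed

lemma sum_deg_nbrs: "(\<Sum>u\<in>nbrs v. deg u) = deg v + card (triangle_nbrs v) + cross v"
proof -
  have "(\<Sum>u\<in>nbrs v. deg u) = (\<Sum>u\<in>nbrs v. 1 + card (nbrs u \<inter> nbrs v) + card (nbrs u \<inter> far v))"
    by (intro sum.cong) (auto simp: deg_nbr card_nbrs_in_nbrs)
  then show ?thesis by (simp add: sum.distrib sum_Suc sum_triangle cross_def)
qed

text \<open>Handshake over the three classes \<open>{v}\<close>, \<open>nbrs v\<close>,
  \<open>far v\<close>. Halved, it reads 3k+2 = d + t + c + s, because the triangle neighbours come
  in t matched pairs.\<close>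

lemma edge_count:
  assumes "v \<in> V"
  shows "2 * (3 * k + 2) = 2 * deg v + card (triangle_nbrs v) + 2 * cross v
    + (\<Sum>w\<in>far v. card (nbrs w \<inter> far v))"
proof -
  have "V = insert v (nbrs v \<union> far v)" using assms nbrs_subset by (auto simp: far_def)
  moreover have "v \<notin> nbrs v \<union> far v" "nbrs v \<inter> far v = {}"
    using nbr_neq by (auto simp: far_def)
  ultimately have "(\<Sum>u\<in>V. deg u) = deg v + ((\<Sum>u\<in>nbrs v. deg u) + (\<Sum>w\<in>far v. deg w))"
    by (metis (no_types, lifting) finite_UnI finite_far finite_nbrs sum.insert sum.union_disjoint)
  moreover have "(\<Sum>w\<in>far v. deg w) = cross v + (\<Sum>w\<in>far v. card (nbrs w \<inter> far v))"
    by (simp add: deg_far cross_far sum.distrib)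
  ultimately show ?thesis using sum_deg size sum_deg_nbrs by simp
qed

text \<open>Let \<open>u'\<close> complete the triangle on \<open>v\<close> and \<open>u\<close>,
  and let \<open>x\<close> be another neighbour of \<open>w\<close> next to \<open>v\<close>. If
  \<open>x = u'\<close>, then \<open>v\<close> and \<open>w\<close> form a diamond on the edge
  \<open>u u'\<close>. Otherwise the edge \<open>vu\<close> with the triangle vertex
  \<open>u'\<close> and the path \<open>v x w u\<close> is a house.\<close>

lemma far_touching_triangle:
  assumes w: "w \<in> far v" and u: "u \<in> nbrs w" "u \<in> triangle_nbrs v"
  shows "nbrs w \<inter> nbrs v = {u}"
proof -
  obtain u' where u': "(u, u') \<in> R" "(v, u') \<in> R" "(v, u) \<in> R"
    using u by (auto simp: triangle_nbrs_def)
  have wu: "(w, u) \<in> R" using u by simp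
  have wn: "w \<noteq> v" "(v, w) \<notin> R" using w by (auto simp: far_def)
  have "x = u" if x: "(w, x) \<in> R" "(v, x) \<in> R" for x
  proof (rule ccontr)
    assume "x \<noteq> u"
    show False
    proof (cases "x = u'")
      case True
      then have "v = w"
        using no_diamond[OF u'(1) nbr_sym[OF u'(3)] u'(2) nbr_sym[OF wu]] x by simp
      then show False using wn by simp
    next
      case False
      have "w \<noteq> u'" using wn u' by auto
      then show False
        using no_house[OF u'(3) u'(2) nbr_sym[OF u'(1)] x(2) nbr_sym[OF x(1)] wu] \<open>x \<noteq> u\<close> False wn
        by simp
    qed
  qed
  then have "nbrs w \<inter> nbrs v \<subseteq> {u}" by blast
  then show ?thesis using u u' by blast
qed

lemma cross_nontriangle:
  assumes "u \<in> nbrs v - triangle_nbrs v"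
  shows "card (nbrs u \<inter> far v) \<ge> 1"
  using deg_nbr[of u v] min_deg[of u] assms nbrs_subset by auto

lemma cross_ge: "deg v - card (triangle_nbrs v) \<le> cross v"
proof -
  have "deg v - card (triangle_nbrs v) = (\<Sum>u\<in>nbrs v - triangle_nbrs v. 1)"
    using card_Diff_subset[OF _ triangle_nbrs_subset] by simp
  also have "\<dots> \<le> (\<Sum>u\<in>nbrs v - triangle_nbrs v. card (nbrs u \<inter> far v))"
    using cross_nontriangle by (intro sum_mono) auto
  also have "\<dots> \<le> cross v"
    unfolding cross_def by (intro sum_mono2) auto
  finally show ?thesis .
qed

lemma card_triangle_le: "card (triangle_nbrs v) \<le> deg v"
  using triangle_nbrs_subset by (simp add: card_mono)

end

section \<open>Possible local structures\<close>

text \<open>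
  At a vertex of degree \<open>d\<close>, \<open>t\<close> counts the triangles, \<open>c\<close> the edges from neighbours to far vertices,
  \<open>s\<close> the edges between far vertices, and \<open>w\<close> the far vertices.
\<close>

lemma local_count_cases:
  fixes k d t c s w :: nat
  assumes k: "k \<ge> 6" and m: "3 * k + 2 = d + t + c + s"
    and c_ge: "d \<le> c + 2 * t" and td: "2 * t \<le> d" and d2: "2 \<le> d"
    and w_le: "2 * w \<le> c + 2 * s"
    and one: "d \<le> 2 * t + 1 \<longrightarrow> c \<le> w \<and> w \<le> 2 * s"
    and s_le: "2 * s \<le> w * (w - 1)"
    and two: "s = 0 \<and> d = 2 * t + 2 \<longrightarrow> c = 2 * w"
  shows "d * d + (d + 2 * t + c) \<le> (2 * k + 1) * d
    \<or> d = 2 * k - 1 \<and> 2 * t + c \<le> 2 * k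
    \<or> d = 2 * k \<and> t = k - 2 \<and> c = 4 \<and> s = 0
    \<or> d = 2 * k - 1 \<and> t = k - 2 \<and> c = 5 \<and> s = 0
    \<or> d = 2 * k \<and> t = k - 1 \<and> c = 2 \<and> s = 1 \<and> w = 2"
proof -
  have small_w: "w \<le> 1 \<Longrightarrow> s = 0" "w \<le> 2 \<Longrightarrow> s \<le> 1"
  proof -
    show "w \<le> 1 \<Longrightarrow> s = 0" using s_le by (cases "w = 0") auto
    assume "w \<le> 2"
    then consider "w = 0" | "w = 1" | "w = 2" by linarith
    then show "s \<le> 1" using s_le by cases simp_all
  qed
  consider "d \<le> 2 * k - 2" | "d = 2 * k - 1" | "d = 2 * k" | "d \<ge> 2 * k + 1" by linarith
  then show ?thesis
  proof cases
    case 1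
    \<comment> \<open>In these variables the claim is d + 2t + c \<le> (j+3)(i+2). Twice the right
      side exceeds the bound 4i+3j+18 by 2ij + 2i + j - 6, which is nonnegative since i + j \<ge>
      8.\<close>
    define i j where "i = d - 2" and "j = 2 * k - 2 - d"
    have i: "d = i + 2" using d2 by (simp add: i_def)
    have k2: "2 * k = i + j + 4" using 1 d2 k by (simp add: i_def j_def)
    have ij: "i + j \<ge> 8" using k2 k by linarith
    have "2 * (2 * t + c) + 2 * d \<le> d + 2 * (3 * k + 2)"
      unfolding m using td by simp
    also have "\<dots> = 4 * i + 3 * j + 18" using k2 i by simp
    finally have A: "2 * (d + 2 * t + c) \<le> 4 * i + 3 * j + 18" by simp
    have B: "4 * i + 3 * j + 18 \<le> 2 * ((j + 3) * (i + 2))"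
      using ij by (simp add: algebra_simps)
    have "d + 2 * t + c \<le> (j + 3) * (i + 2)" using order.trans[OF A B] by simp
    moreover have "(2 * k + 1) * d = d * d + (j + 3) * (i + 2)"
      unfolding k2 i by (simp add: algebra_simps)
    ultimately show ?thesis by simp
  next
    case 2
    consider "t = k - 1" | "t = k - 2" | "t + 3 \<le> k" using td 2 k by linarith
    then show ?thesis
    proof cases
      case 1
      \<comment> \<open>Only one neighbour lies on no triangle, so \<open>one\<close> bounds c by
        2s; as c + s = 4, this leaves c \<le> 2.\<close>
      then have "d \<le> 2 * t + 1" using 2 k by simp
      then have "c \<le> 2 * s" using one by simp
      then have "2 * t + c \<le> 2 * k" using 1 2 m k by simp
      then show ?thesis using 2 by blast
    next
      case t: 2
      then have "c + s = 5" using 2 m k by linarith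
      then consider "c = 5" "s = 0" | "2 * t + c \<le> 2 * k" using t k by linarith
      then show ?thesis using 2 t by cases blast+
    next
      case 3
      then have "2 * t + c \<le> 2 * k" using 2 m k by linarith
      then show ?thesis using 2 by blast
    qed
  next
    case 3
    consider "t = k" | "t = k - 1" | "t = k - 2" | "t + 3 \<le> k" using td 3 k by linarith
    then show ?thesis
    proof cases
      case 1
      \<comment> \<open>The two leftover edges cannot be placed: s = 0 leaves no far vertex and
        hence c = 0, s = 1 leaves at most one far vertex, and s = 2 at most two, too few to carry s
        edges.\<close>
      then have "c \<le> w" "w \<le> 2 * s" using one 3 by simp_all
      moreover have "c + s = 2" using 1 3 m by simp
      ultimately have "w \<le> 2" "s \<noteq> 0" "s = 2 \<or> w \<le> 1" using w_le by linarith+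
      then show ?thesis using small_w by auto
    next
      case 2
      have cs: "c + s = 3" "c \<ge> 2" using 2 3 m k c_ge by linarith+
      show ?thesis
      proof (cases "s = 0")
        case True
        \<comment> \<open>A parity conflict: with s = 0 the count gives c = 3.\<close>
        then have "c = 2 * w" using two 2 3 k by simp
        then show ?thesis using cs True by presburger
      next
        case False
        then have "s = 1" "c = 2" using cs by linarith+
        moreover from this have "w = 2" using small_w(1) w_le by fastforce
        ultimately show ?thesis using 2 3 by blast
      qed
    next
      case t: 3
      then have "c + s = 4" "c \<ge> 4" using 3 m k c_ge by linarith+
      then show ?thesis using t 3 by simp
    next
      case 4
      then show ?thesis using 3 m c_ge by linarith
    qed
  next
    case 4
    \<comment> \<open>Combining m with \<open>c_ge\<close> gives 2d - t \<le> 3k+2, and t is at most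
      d/2. So d = 2k+1 and t = k are forced, hence c = 1 and s = 0; that single cross edge then
      violates \<open>one\<close>.\<close>
    have "t = k" using m c_ge td 4 by linarith
    then have "d = 2 * k + 1" using m c_ge td 4 by linarith
    then have "s = 0" "d \<le> 2 * t + 1" "c \<noteq> 0" using m c_ge td \<open>t = k\<close> by linarith+
    then show ?thesis using one by simp
  qed
qed

context theta_free_graph
begin

definition inner :: "'a \<Rightarrow> nat" where
  "inner v = (\<Sum>w\<in>far v. card (nbrs w \<inter> far v)) div 2"

lemma inner_eq: "2 * inner v = (\<Sum>w\<in>far v. card (nbrs w \<inter> far v))"
  unfolding inner_def using even_sum_card[of "far v"] by simp

text \<open>A far vertex touching a triangle neighbour has no other neighbour next to
  \<open>v\<close>; any other far vertex only sees neighbours that lie on no triangle.\<close>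

lemma card_nbrs_in_nbrs_far_le:
  assumes "w \<in> far v"
  shows "card (nbrs w \<inter> nbrs v) \<le> max 1 (deg v - card (triangle_nbrs v))"
proof (cases "nbrs w \<inter> triangle_nbrs v = {}")
  case True
  then have "nbrs w \<inter> nbrs v \<subseteq> nbrs v - triangle_nbrs v" by blast
  then have "card (nbrs w \<inter> nbrs v) \<le> card (nbrs v - triangle_nbrs v)"
    by (intro card_mono) auto
  then show ?thesis using card_Diff_subset[OF _ triangle_nbrs_subset, of v] by simp
next
  case False
  then obtain u where "u \<in> nbrs w" "u \<in> triangle_nbrs v" by blast
  then show ?thesis using far_touching_triangle[OF assms] by simp
qed

lemma far_deg_ge: "w \<in> far v \<Longrightarrow> 2 \<le> card (nbrs w \<inter> nbrs v) + card (nbrs w \<inter> far v)"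
  using deg_far[of w v] min_deg[of w] by (simp add: far_def)

text \<open>With no far edges, a far vertex takes its degree of at least 2 entirely from
  \<open>nbrs v\<close>, and a triangle neighbour would have been its only neighbour there.\<close>

lemma inner_zero:
  assumes "inner v = 0" "w \<in> far v"
  shows "nbrs w \<inter> far v = {}" "nbrs w \<subseteq> nbrs v - triangle_nbrs v"
proof -
  have "(\<Sum>w\<in>far v. card (nbrs w \<inter> far v)) = 0" using inner_eq[of v] assms(1) by simp
  then have "card (nbrs w \<inter> far v) = 0" using assms(2) by simp
  then show *: "nbrs w \<inter> far v = {}" by simp
  have "2 \<le> card (nbrs w \<inter> nbrs v)" using far_deg_ge[OF assms(2)] * by simp
  then have "nbrs w \<inter> triangle_nbrs v = {}" using far_touching_triangle[OF assms(2)] by fastforce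
  moreover have "v \<notin> nbrs w" using assms(2) nbr_sym[of w v] by (auto simp: far_def)
  ultimately show "nbrs w \<subseteq> nbrs v - triangle_nbrs v"
    using * nbrs_subset[of w] by (auto simp: far_def)
qed

text \<open>The cases are sorted by the quotient of the degree vector at \<open>v\<close>. It is at
  most 2k+1 in \<open>small\<close> and at most 2k+1+1/(2k-1) in \<open>near\<close>, both below
  \<open>q_lower k\<close>. It equals 2k+2 in \<open>even_indep\<close> and \<open>extremal\<close>
  and 2k+1+2/(2k-1) in \<open>odd_indep\<close>, all above it.\<close>

lemma vertex_cases:
  assumes v: "v \<in> V"
  obtains
    (small) "deg v * deg v + (\<Sum>u\<in>nbrs v. deg u) \<le> (2 * k + 1) * deg v"
  | (near) "deg v = 2 * k - 1" "(\<Sum>u\<in>nbrs v. deg u) \<le> 4 * k - 1"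
  | (even_indep) "deg v = 2 * k" "card (triangle_nbrs v) = 2 * (k - 2)" "cross v = 4" "inner v = 0"
  | (odd_indep) "deg v = 2 * k - 1" "card (triangle_nbrs v) = 2 * (k - 2)" "cross v = 5" "inner v = 0"
  | (extremal) "deg v = 2 * k" "card (triangle_nbrs v) = 2 * (k - 1)" "cross v = 2" "inner v = 1"
      "card (far v) = 2"
proof -
  define t where "t = card (triangle_nbrs v) div 2"
  have t: "card (triangle_nbrs v) = 2 * t" using even_triangle by (simp add: t_def)
  have E: "cross v = (\<Sum>w\<in>far v. card (nbrs w \<inter> nbrs v))" by (rule cross_far)
  have f1: "3 * k + 2 = deg v + t + cross v + inner v"
    using edge_count[OF v, folded inner_eq] t by simp
  have f2: "deg v \<le> cross v + 2 * t" using cross_ge[of v] t by linarith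
  have f3: "2 * t \<le> deg v" using card_triangle_le[of v] t by linarith
  have f4: "2 * card (far v) \<le> cross v + 2 * inner v"
  proof -
    have "2 * card (far v) = (\<Sum>w\<in>far v. 2)" by simp
    also have "\<dots> \<le> (\<Sum>w\<in>far v. card (nbrs w \<inter> nbrs v) + card (nbrs w \<inter> far v))"
      by (intro sum_mono far_deg_ge)
    finally show ?thesis by (simp add: sum.distrib E inner_eq)
  qed
  \<comment> \<open>With at most one neighbour off the triangles, a far vertex has at most one
    neighbour next to \<open>v\<close>, so its second neighbour must be far.\<close>
  have f5: "deg v \<le> 2 * t + 1 \<longrightarrow> cross v \<le> card (far v) \<and> card (far v) \<le> 2 * inner v"
  proof
    assume "deg v \<le> 2 * t + 1"
    have le1: "card (nbrs w \<inter> nbrs v) \<le> 1" if "w \<in> far v" for w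
      using card_nbrs_in_nbrs_far_le[OF that] t \<open>deg v \<le> 2 * t + 1\<close> by simp
    then have "cross v \<le> (\<Sum>w\<in>far v. 1)" unfolding E by (intro sum_mono)
    moreover have "(\<Sum>w\<in>far v. 1) \<le> (\<Sum>w\<in>far v. card (nbrs w \<inter> far v))"
    proof (rule sum_mono)
      fix w assume "w \<in> far v"
      then show "1 \<le> card (nbrs w \<inter> far v)" using le1[of w] far_deg_ge[of w v] by linarith
    qed
    ultimately show "cross v \<le> card (far v) \<and> card (far v) \<le> 2 * inner v"
      by (simp add: inner_eq)
  qed
  have f6: "2 * inner v \<le> card (far v) * (card (far v) - 1)"
  proof -
    have "card (nbrs w \<inter> far v) \<le> card (far v) - 1" if "w \<in> far v" for w
    proof -
      have "nbrs w \<inter> far v \<subseteq> far v - {w}" using nbr_neq[of w w] by auto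
      then have "card (nbrs w \<inter> far v) \<le> card (far v - {w})" by (intro card_mono) auto
      then show ?thesis using that by simp
    qed
    then have "(\<Sum>w\<in>far v. card (nbrs w \<inter> far v)) \<le> of_nat (card (far v)) * (card (far v) - 1)"
      by (intro sum_bounded_above)
    then show ?thesis by (simp add: inner_eq)
  qed
  \<comment> \<open>Each far vertex needs two neighbours next to \<open>v\<close>, and exactly two
    neighbours are off the triangles.\<close>
  have f7: "inner v = 0 \<and> deg v = 2 * t + 2 \<longrightarrow> cross v = 2 * card (far v)"
  proof (intro impI, elim conjE)
    assume "inner v = 0" "deg v = 2 * t + 2"
    have "card (nbrs w \<inter> nbrs v) = 2" if "w \<in> far v" for w
      using far_deg_ge[OF that] inner_zero(1)[OF \<open>inner v = 0\<close> that]
        card_nbrs_in_nbrs_far_le[OF that] t \<open>deg v = 2 * t + 2\<close> by simp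
    then show "cross v = 2 * card (far v)" by (simp add: E)
  qed
  have sum: "(\<Sum>u\<in>nbrs v. deg u) = deg v + 2 * t + cross v"
    using sum_deg_nbrs[of v] t by simp
  from local_count_cases[OF k6 f1 f2 f3 min_deg[OF v] f4 f5 f6 f7] show ?thesis
  proof (elim disjE conjE)
    assume "deg v * deg v + (deg v + 2 * t + cross v) \<le> (2 * k + 1) * deg v"
    then show ?thesis using small sum by simp
  next
    assume "deg v = 2 * k - 1" "2 * t + cross v \<le> 2 * k"
    then show ?thesis using near sum by simp
  next
    assume "deg v = 2 * k" "t = k - 2" "cross v = 4" "inner v = 0"
    then show ?thesis using even_indep t by simp
  next
    assume "deg v = 2 * k - 1" "t = k - 2" "cross v = 5" "inner v = 0"
    then show ?thesis using odd_indep t by simp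
  next
    assume "deg v = 2 * k" "t = k - 1" "cross v = 2" "inner v = 1" "card (far v) = 2"
    then show ?thesis using extremal t by simp
  qed
qed

end

section \<open>The signless Laplacian spectral radius\<close>

lemma sum_cnj_quadratic:
  fixes A :: "nat \<Rightarrow> nat \<Rightarrow> real" and z :: "nat \<Rightarrow> complex"
  assumes "\<And>i j. i < n \<Longrightarrow> j < n \<Longrightarrow> A i j = A j i"
  shows "cnj (\<Sum>i<n. cnj (z i) * (\<Sum>j<n. of_real (A i j) * z j))
    = (\<Sum>i<n. cnj (z i) * (\<Sum>j<n. of_real (A i j) * z j))"
proof -
  have "cnj (\<Sum>i<n. cnj (z i) * (\<Sum>j<n. of_real (A i j) * z j))
      = (\<Sum>i<n. \<Sum>j<n. z i * of_real (A i j) * cnj (z j))"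
    by (simp add: sum_distrib_left mult.assoc)
  also have "\<dots> = (\<Sum>j<n. \<Sum>i<n. z i * of_real (A i j) * cnj (z j))"
    by (rule sum.swap)
  also have "\<dots> = (\<Sum>j<n. \<Sum>i<n. cnj (z j) * (of_real (A j i) * z i))"
    using assms by (intro sum.cong refl) simp
  finally show ?thesis by (simp add: sum_distrib_left)
qed

text \<open>Ensures that the \<open>Max\<close> in \<open>q_radius\<close> is taken over a nonempty
  set. A complex eigenvalue always exists; pairing the eigenvalue equation with the conjugate of
  \<open>z\<close> gives \<mu> times the positive number \<open>s\<close>, which is real by
  \<open>sum_cnj_quadratic\<close>, so \<mu> is real.\<close>

lemma spectrum_symmetric_nonempty:
  fixes A :: "real mat"
  assumes A: "A \<in> carrier_mat n n" and n: "n > 0"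
    and sym: "\<And>i j. i < n \<Longrightarrow> j < n \<Longrightarrow> A $$ (i, j) = A $$ (j, i)"
  shows "spectrum A \<noteq> {}"
proof -
  let ?B = "map_mat complex_of_real A"
  have B: "?B \<in> carrier_mat n n" using A by simp
  obtain \<mu> where "\<mu> \<in> spectrum ?B" using spectrum_non_empty[OF B n] by blast
  then have ev: "eigenvalue ?B \<mu>" by (simp add: spectrum_def)
  then obtain z where z: "z \<in> carrier_vec n" "z \<noteq> 0\<^sub>v n" "?B *\<^sub>v z = \<mu> \<cdot>\<^sub>v z"
    using B by (auto simp: eigenvalue_def eigenvector_def)
  have row: "(\<Sum>j<n. of_real (A $$ (i, j)) * z $ j) = \<mu> * z $ i" if "i < n" for i
  proof -
    have "(\<Sum>j<n. of_real (A $$ (i, j)) * z $ j) = (?B *\<^sub>v z) $ i"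
      using that A z(1) by (simp add: scalar_prod_def lessThan_atLeast0)
    then show ?thesis using z that by simp
  qed
  define s where "s = (\<Sum>i<n. (cmod (z $ i))\<^sup>2)"
  have "(\<Sum>i<n. cnj (z $ i) * (\<Sum>j<n. of_real (A $$ (i, j)) * z $ j))
      = (\<Sum>i<n. \<mu> * of_real ((cmod (z $ i))\<^sup>2))"
  proof (intro sum.cong refl)
    fix i assume "i \<in> {..<n}"
    then have "cnj (z $ i) * (\<Sum>j<n. of_real (A $$ (i, j)) * z $ j) = cnj (z $ i) * (\<mu> * z $ i)"
      using row by simp
    also have "\<dots> = \<mu> * of_real ((cmod (z $ i))\<^sup>2)"
      by (simp only: complex_norm_square mult_ac)
    finally show "cnj (z $ i) * (\<Sum>j<n. of_real (A $$ (i, j)) * z $ j)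
      = \<mu> * of_real ((cmod (z $ i))\<^sup>2)" .
  qed
  also have "\<dots> = \<mu> * of_real s" by (simp add: s_def sum_distrib_left)
  finally have "cnj (\<mu> * of_real s) = \<mu> * of_real s"
    using sum_cnj_quadratic[of n "\<lambda>i j. A $$ (i, j)" "\<lambda>i. z $ i"] sym by simp
  moreover obtain i where "i < n" "z $ i \<noteq> 0"
    using z(1,2) by (metis carrier_vecD eq_vecI index_zero_vec)
  then have "s > 0" unfolding s_def by (intro sum_pos2[of _ i]) auto
  ultimately have "cnj \<mu> = \<mu>" by simp
  then obtain r where r: "\<mu> = of_real r" by (metis Reals_cnj_iff Reals_cases)
  have "poly (char_poly ?B) (of_real r) = 0"
    using ev eigenvalue_root_char_poly[OF B] r by simp
  then have "of_real (poly (char_poly A) r) = (0 :: complex)"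
    by (simp add: of_real_hom.char_poly_hom[OF A])
  then have "eigenvalue A r" using eigenvalue_root_char_poly[OF A] by simp
  then show ?thesis by (auto simp: spectrum_def)
qed

context simple_graph
begin

text \<open>The signless Laplacian as an operator on functions on the vertices, so that test vectors
  need no enumeration of the vertices.\<close>

definition Q_apply :: "('a \<Rightarrow> real) \<Rightarrow> 'a \<Rightarrow> real" where
  "Q_apply x v = real (deg v) * x v + (\<Sum>u\<in>nbrs v. x u)"

text \<open>
  Collatz--Wielandt: compare an eigenvector \<open>y\<close> with the positive vector \<open>x\<close> at a vertex
  maximizing \<open>\<bar>y v\<bar> / x v\<close>.
\<close>

lemma Q_eigenvalue_bound:
  assumes pos: "\<And>v. v \<in> V \<Longrightarrow> x v > 0"
    and eig: "\<And>v. v \<in> V \<Longrightarrow> Q_apply y v = \<mu> * y v"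
    and nz: "w \<in> V" "y w \<noteq> 0"
  shows "\<exists>v\<in>V. \<mu> * x v \<le> Q_apply x v"
proof -
  define c where "c = Max ((\<lambda>v. \<bar>y v\<bar> / x v) ` V)"
  have fin: "finite ((\<lambda>v. \<bar>y v\<bar> / x v) ` V)" using finite_V by simp
  then have "c \<in> (\<lambda>v. \<bar>y v\<bar> / x v) ` V" unfolding c_def using nz(1) by (intro Max_in) auto
  then obtain v where v: "v \<in> V" "c = \<bar>y v\<bar> / x v" by blast
  have le: "\<bar>y u\<bar> \<le> c * x u" if "u \<in> V" for u
  proof -
    have "\<bar>y u\<bar> / x u \<le> c" unfolding c_def using fin that by (intro Max_ge) auto
    then show ?thesis using pos[OF that] by (simp add: pos_divide_le_eq)
  qed
  have "0 < c * x w" using le[OF nz(1)] nz(2) by linarith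
  then have c: "c > 0" using pos[OF nz(1)] by (simp add: zero_less_mult_iff)
  have yv: "\<bar>y v\<bar> = c * x v" using v pos[OF v(1)] by simp
  have "c * (\<mu> * x v) = \<mu> * \<bar>y v\<bar>" by (simp add: yv)
  also have "\<dots> \<le> \<bar>\<mu> * y v\<bar>" by (simp add: abs_mult mult_right_mono)
  also have "\<dots> = \<bar>Q_apply y v\<bar>" using eig[OF v(1)] by simp
  also have "\<dots> \<le> real (deg v) * \<bar>y v\<bar> + (\<Sum>u\<in>nbrs v. \<bar>y u\<bar>)"
    unfolding Q_apply_def by (intro order.trans[OF abs_triangle_ineq] add_mono) (auto simp: abs_mult)
  also have "\<dots> \<le> real (deg v) * (c * x v) + (\<Sum>u\<in>nbrs v. c * x u)"
    using nbrs_subset by (intro add_mono sum_mono le) (auto simp: yv)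
  also have "\<dots> = c * Q_apply x v" by (simp add: Q_apply_def sum_distrib_left algebra_simps)
  finally have "\<mu> * x v \<le> Q_apply x v" using c by simp
  then show ?thesis using v(1) by blast
qed

end

section \<open>Transfer between matrices and functions on the vertices\<close>

lemma simple_graph_pair_graph:
  assumes "pair_graph G"
  shows "simple_graph (pverts G) (parcs G)"
proof -
  interpret G: pair_graph G by (rule assms)
  show ?thesis
  proof
    show "parcs G \<subseteq> pverts G \<times> pverts G" by (auto dest: G.in_arcsD1 G.in_arcsD2)
    show "sym (parcs G)" using G.arcs_symmetric by (auto simp: sym_def)
    show "irrefl (parcs G)" using G.no_loops' by (auto simp: irrefl_def)
  qed simp
qed

lemma degree_of_eq: "degree_of G v = card (parcs G `` {v})"
proof -
  have "out_arcs (with_proj G) v = Pair v ` (parcs G `` {v})" by (auto simp: out_arcs_def)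
  then show ?thesis by (simp add: degree_of_def out_degree_def card_image inj_on_def)
qed

lemma signless_laplacian_carrier:
  "signless_laplacian G \<in> carrier_mat (card (pverts G)) (card (pverts G))"
  by (simp add: signless_laplacian_def degree_mat_def adjacency_mat_def)

lemma signless_laplacian_index:
  assumes "i < card (pverts G)" "j < card (pverts G)"
  shows "signless_laplacian G $$ (i, j) =
    (if i = j then real (degree_of G (from_nat_into (pverts G) i)) else 0)
    + (if (from_nat_into (pverts G) i, from_nat_into (pverts G) j) \<in> parcs G then 1 else 0)"
  using assms by (simp add: signless_laplacian_def degree_mat_def adjacency_mat_def)

locale embedded_graph = simple_graph "pverts G" "parcs G" for G :: "'a pair_pre_digraph"
begin

abbreviation (input) enum :: "nat \<Rightarrow> 'a" where "enum \<equiv> from_nat_into (pverts G)"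

lemma bij_enum: "bij_betw enum {..<card (pverts G)} (pverts G)"
  by (rule bij_betw_from_nat_into_finite[OF finite_V])

lemma signless_laplacian_mult:
  assumes i: "i < card (pverts G)" and w: "w \<in> carrier_vec (card (pverts G))"
    and y: "\<And>j. j < card (pverts G) \<Longrightarrow> w $ j = y (enum j)"
  shows "(signless_laplacian G *\<^sub>v w) $ i = Q_apply y (enum i)"
proof -
  let ?n = "card (pverts G)"
  have "(signless_laplacian G *\<^sub>v w) $ i = (\<Sum>j<?n. signless_laplacian G $$ (i, j) * w $ j)"
    using i w signless_laplacian_carrier[of G] by (simp add: scalar_prod_def lessThan_atLeast0)
  also have "\<dots> = (\<Sum>j<?n. (if i = j then real (deg (enum i)) * y (enum j) else 0)
      + (if (enum i, enum j) \<in> parcs G then y (enum j) else 0))"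
    using i by (intro sum.cong refl)
      (auto simp: signless_laplacian_index degree_of_eq y algebra_simps)
  also have "\<dots> = real (deg (enum i)) * y (enum i)
      + (\<Sum>j<?n. if (enum i, enum j) \<in> parcs G then y (enum j) else 0)"
    using i by (simp add: sum.distrib)
  also have "(\<Sum>j<?n. if (enum i, enum j) \<in> parcs G then y (enum j) else 0)
      = (\<Sum>u\<in>pverts G. if (enum i, u) \<in> parcs G then y u else 0)"
    by (rule sum.reindex_bij_betw[OF bij_enum])
  also have "\<dots> = (\<Sum>u\<in>pverts G \<inter> {u. (enum i, u) \<in> parcs G}. y u)"
    using sum.inter_restrict[OF finite_V, of y "{u. (enum i, u) \<in> parcs G}"] by simp
  also have "pverts G \<inter> {u. (enum i, u) \<in> parcs G} = nbrs (enum i)"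
    using nbrs_subset by auto
  finally show ?thesis by (simp add: Q_apply_def)
qed

lemma eigenvalueD:
  assumes "eigenvalue (signless_laplacian G) \<mu>"
  obtains y w where "\<And>v. v \<in> pverts G \<Longrightarrow> Q_apply y v = \<mu> * y v" "w \<in> pverts G" "y w \<noteq> 0"
proof -
  let ?n = "card (pverts G)"
  obtain z where z: "z \<in> carrier_vec ?n" "z \<noteq> 0\<^sub>v ?n" "signless_laplacian G *\<^sub>v z = \<mu> \<cdot>\<^sub>v z"
    using assms signless_laplacian_carrier[of G] by (auto simp: eigenvalue_def eigenvector_def)
  define y where "y v = z $ (the_inv_into {..<?n} enum v)" for v
  have y: "z $ j = y (enum j)" if "j < ?n" for j
    using bij_enum that by (simp add: y_def bij_betw_def the_inv_into_f_f)
  have surj: "\<exists>i<?n. v = enum i" if "v \<in> pverts G" for v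
    using bij_enum that by (auto simp: bij_betw_def)
  have "Q_apply y v = \<mu> * y v" if v: "v \<in> pverts G" for v
  proof -
    obtain i where i: "i < ?n" "v = enum i" using surj[OF v] by blast
    have "Q_apply y v = (signless_laplacian G *\<^sub>v z) $ i"
      using signless_laplacian_mult[OF i(1) z(1) y] i(2) by simp
    also have "\<dots> = \<mu> * z $ i" using z i(1) by simp
    finally show ?thesis using y[OF i(1)] i(2) by simp
  qed
  moreover obtain i where "i < ?n" "z $ i \<noteq> 0"
    using z(1,2) by (metis carrier_vecD eq_vecI index_zero_vec)
  then have "enum i \<in> pverts G" "y (enum i) \<noteq> 0"
    using y bij_enum by (auto simp: bij_betw_def)
  ultimately show ?thesis using that by blast
qed

lemma eigenvalueI:
  assumes "\<And>v. v \<in> pverts G \<Longrightarrow> Q_apply y v = \<mu> * y v" "w \<in> pverts G" "y w \<noteq> 0"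
  shows "eigenvalue (signless_laplacian G) \<mu>"
proof -
  let ?n = "card (pverts G)"
  define z where "z = vec ?n (\<lambda>j. y (enum j))"
  have z: "z \<in> carrier_vec ?n" "\<And>j. j < ?n \<Longrightarrow> z $ j = y (enum j)" by (auto simp: z_def)
  have "signless_laplacian G *\<^sub>v z = \<mu> \<cdot>\<^sub>v z"
  proof (rule eq_vecI)
    fix i assume "i < dim_vec (\<mu> \<cdot>\<^sub>v z)"
    then have i: "i < ?n" using z(1) by simp
    then have "enum i \<in> pverts G" using bij_enum by (auto simp: bij_betw_def)
    then show "(signless_laplacian G *\<^sub>v z) $ i = (\<mu> \<cdot>\<^sub>v z) $ i"
      using signless_laplacian_mult[OF i z] assms(1) i z by simp
  qed (use z(1) signless_laplacian_carrier[of G] in auto)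
  moreover obtain i where "i < ?n" "w = enum i"
    using bij_enum assms(2) by (auto simp: bij_betw_def)
  then have "z \<noteq> 0\<^sub>v ?n" using assms(3) z by (metis index_zero_vec(1))
  ultimately show ?thesis
    using z(1) signless_laplacian_carrier[of G] by (auto simp: eigenvalue_def eigenvector_def)
qed

lemma spectrum_finite_nonempty:
  assumes "pverts G \<noteq> {}"
  shows "finite (spectrum (signless_laplacian G))" "spectrum (signless_laplacian G) \<noteq> {}"
proof -
  show "finite (spectrum (signless_laplacian G))"
    by (rule card_finite_spectrum[OF signless_laplacian_carrier])
  have "card (pverts G) > 0" using assms finite_V by (simp add: card_gt_0_iff)
  moreover have "(enum i, enum j) \<in> parcs G \<longleftrightarrow> (enum j, enum i) \<in> parcs G" for i j
    using nbr_sym by blast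
  ultimately show "spectrum (signless_laplacian G) \<noteq> {}"
    by (intro spectrum_symmetric_nonempty[OF signless_laplacian_carrier])
      (auto simp: signless_laplacian_index)
qed

lemma q_radius_less:
  assumes "pverts G \<noteq> {}" and pos: "\<And>v. v \<in> pverts G \<Longrightarrow> x v > 0"
    and less: "\<And>v. v \<in> pverts G \<Longrightarrow> Q_apply x v < l * x v"
  shows "q_radius G < l"
proof -
  have "\<mu> < l" if "\<mu> \<in> spectrum (signless_laplacian G)" for \<mu>
  proof -
    from that have "eigenvalue (signless_laplacian G) \<mu>" by (simp add: spectrum_def)
    then obtain y w where y: "\<And>v. v \<in> pverts G \<Longrightarrow> Q_apply y v = \<mu> * y v" "w \<in> pverts G" "y w \<noteq> 0"
      using eigenvalueD by metis
    obtain v where v: "v \<in> pverts G" "\<mu> * x v \<le> Q_apply x v"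
      using Q_eigenvalue_bound[of x y \<mu> w, OF pos y] by blast
    then show ?thesis using less[OF v(1)] pos[OF v(1)]
      by (meson le_less_trans mult_less_cancel_right_pos)
  qed
  then show ?thesis unfolding q_radius_def using spectrum_finite_nonempty[OF assms(1)] by simp
qed

text \<open>The positive eigenvector serves twice: as a test vector it bounds every eigenvalue by
  \<open>l\<close>, and as an eigenvector it puts \<open>l\<close> into the spectrum.\<close>

lemma q_radius_eq:
  assumes "pverts G \<noteq> {}" and pos: "\<And>v. v \<in> pverts G \<Longrightarrow> x v > 0"
    and eig: "\<And>v. v \<in> pverts G \<Longrightarrow> Q_apply x v = l * x v"
  shows "q_radius G = l"
proof -
  have "\<mu> \<le> l" if "\<mu> \<in> spectrum (signless_laplacian G)" for \<mu>
  proof -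
    from that have "eigenvalue (signless_laplacian G) \<mu>" by (simp add: spectrum_def)
    then obtain y w where y: "\<And>v. v \<in> pverts G \<Longrightarrow> Q_apply y v = \<mu> * y v" "w \<in> pverts G" "y w \<noteq> 0"
      using eigenvalueD by metis
    obtain v where v: "v \<in> pverts G" "\<mu> * x v \<le> Q_apply x v"
      using Q_eigenvalue_bound[of x y \<mu> w, OF pos y] by blast
    then show ?thesis using eig[OF v(1)] pos[OF v(1)] by simp
  qed
  moreover obtain w where "w \<in> pverts G" using assms(1) by blast
  then have "l \<in> spectrum (signless_laplacian G)"
    using eigenvalueI[OF eig] pos[of w] by (auto simp: spectrum_def)
  ultimately show ?thesis
    unfolding q_radius_def using spectrum_finite_nonempty[OF assms(1)] by (intro Max_eqI) auto
qed

end

section \<open>The quartic\<close>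

text \<open>
  The offset \<open>6 / (6 k + 1)\<close> is tuned: it must exceed \<open>1 / (2 k - 1)\<close> for the degree vector, be
  large enough for the case of degree \<open>2 k\<close> with \<open>k - 2\<close> triangles, and stay below the largest
  root of the quartic; the true offset is \<open>1 / k + O(1 / k\<^sup>3)\<close>.
\<close>

definition q_lower :: "nat \<Rightarrow> real" where
  "q_lower k = 2 * real k + 1 + 6 / (6 * real k + 1)"

lemma q_lower_gt: "2 * real k + 1 < q_lower k"
  by (simp add: q_lower_def add_pos_nonneg)

text \<open>
  The form of the quartic that arises by eliminating the other entries from the eigenvalue equation
  at the central vertex of the extremal graph.
\<close>

definition quartic :: "nat \<Rightarrow> real \<Rightarrow> real" where
  "quartic k x = (x - 2 * k - 1) * (x - 2) * ((x - 3) * (x - 2) - 1) - 2 * (x - 3)\<^sup>2"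

lemma q_bound_eq_Max_quartic:
  assumes "m = 3 * k + 2"
  shows "q_bound m = Max {x. quartic k x = 0}"
proof -
  have "x ^ 4 - 2 / 3 * (real m + 10) * x ^ 3 + 2 / 3 * (7 * real m + 16) * x\<^sup>2
       - (10 * real m - 7) * x + 4 / 3 * (5 * real m - 16) = quartic k x" for x :: real
    unfolding quartic_def assms by (simp add: field_simps power2_eq_square power3_eq_cube power4_eq_xxxx)
  then show ?thesis by (simp add: q_bound_def)
qed

lemma finite_quartic_roots: "finite {x. quartic k x = 0}"
proof -
  define p :: "real poly" where
    "p = [:- 2 * real k - 1, 1:] * [:-2, 1:] * ([:-3, 1:] * [:-2, 1:] - 1) - [:2:] * [:-3, 1:] ^ 2"
  have "poly p x = quartic k x" for x
    by (simp add: p_def quartic_def algebra_simps)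
  moreover have "p \<noteq> 0"
  proof
    assume "p = 0"
    then have "poly p 2 = 0" by simp
    then show False by (simp add: p_def)
  qed
  ultimately show ?thesis using poly_roots_finite[of p] by simp
qed

text \<open>With a = x - 3 and e = x - 2k - 1 the quartic is e (a^3 + 2a^2 - 1) - 2a^2. Multiplying
  by 3d + 1 = 6/e, which is also 3a + 7 - 3e, cancels the cubic terms and leaves -(2(1-3e)a^2 + 6);
  e < 1/3 holds because d \<ge> 12.\<close>

lemma quartic_q_lower_neg:
  assumes "k \<ge> 6"
  shows "quartic k (q_lower k) < 0"
proof -
  define d e where "d = 2 * real k" and "e = 6 / (3 * d + 1)"
  define a where "a = d - 2 + e"
  have d: "d \<ge> 12" using assms by (simp add: d_def)
  then have e: "0 < e" "e < 1 / 3" "e * (3 * d + 1) = 6"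
    by (auto simp: e_def field_simps)
  have a: "a > 0" using d e by (simp add: a_def)
  have "quartic k (q_lower k) = e * (a + 1) * (a * (a + 1) - 1) - 2 * a\<^sup>2"
    by (simp add: quartic_def q_lower_def a_def d_def e_def algebra_simps)
  moreover have "(3 * d + 1) * (e * (a + 1) * (a * (a + 1) - 1) - 2 * a\<^sup>2) < 0"
  proof -
    have d': "3 * d + 1 = 3 * a + 7 - 3 * e" by (simp add: a_def)
    have "(3 * d + 1) * (e * (a + 1) * (a * (a + 1) - 1) - 2 * a\<^sup>2)
        = (e * (3 * d + 1)) * ((a + 1) * (a * (a + 1) - 1)) - 2 * (3 * d + 1) * a\<^sup>2"
      by (simp add: algebra_simps)
    also have "\<dots> = 6 * ((a + 1) * (a * (a + 1) - 1)) - 2 * (3 * a + 7 - 3 * e) * a\<^sup>2"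
      unfolding e(3) by (simp only: d')
    also have "\<dots> = - (2 * (1 - 3 * e) * a\<^sup>2 + 6)"
      by (simp add: algebra_simps power2_eq_square)
    also have "\<dots> < 0"
    proof -
      have "0 \<le> 2 * (1 - 3 * e) * a\<^sup>2" using e by simp
      then show ?thesis by linarith
    qed
    finally show ?thesis .
  qed
  ultimately show ?thesis using d by (simp add: mult_less_0_iff)
qed

text \<open>The quartic is negative at \<open>q_lower k\<close> and equals (2k-1)^3 - 1 at 2k+2, so
  it has a root in between, and the largest root is at least that one.\<close>

lemma q_bound_root_gt:
  assumes "k \<ge> 6" and "m = 3 * k + 2"
  shows "quartic k (q_bound m) = 0" "q_lower k < q_bound m"
proof -
  let ?u = "2 * real k + 2"
  have "6 / (6 * real k + 1) \<le> 1" using assms(1) by (simp add: field_simps)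
  then have le: "q_lower k \<le> ?u" by (simp add: q_lower_def)
  have "quartic k ?u = (2 * real k - 1) ^ 3 - 1"
    by (simp add: quartic_def algebra_simps power2_eq_square power3_eq_cube)
  also have "\<dots> \<ge> 0" using assms(1) by simp
  finally have "quartic k ?u \<ge> 0" .
  moreover have "continuous_on {q_lower k..?u} (quartic k)"
    unfolding quartic_def by (intro continuous_intros)
  ultimately obtain x where x: "q_lower k \<le> x" "quartic k x = 0"
    using IVT'[of "quartic k" "q_lower k" 0 ?u] quartic_q_lower_neg[OF assms(1)] le by force
  then have mem: "x \<in> {x. quartic k x = 0}" by simp
  have "q_bound m \<in> {x. quartic k x = 0}"
    unfolding q_bound_eq_Max_quartic[OF assms(2)] using mem
    by (intro Max_in[OF finite_quartic_roots]) blast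
  then show r: "quartic k (q_bound m) = 0" by simp
  have "x \<le> q_bound m"
    unfolding q_bound_eq_Max_quartic[OF assms(2)] by (rule Max_ge[OF finite_quartic_roots mem])
  moreover have "x \<noteq> q_lower k" using x(2) quartic_q_lower_neg[OF assms(1)] by auto
  ultimately show "q_lower k < q_bound m" using x(1) by simp
qed

text \<open>The inequality at the centre in \<open>even_indep_weight\<close>. Both sides are 1 + 2/d
  to first order; the gap is about 4/(3 d^2), so this case comes close to the extremal graph and
  leaves no room for cruder weights.\<close>

lemma even_indep_estimate:
  fixes d :: real
  assumes "d \<ge> 12"
  shows "(d - 4) * ((d + 1) / (d * (d - 1))) + 4 * ((d - 3) * (d + 1) / (d ^ 3 - 3 * d\<^sup>2 - 3 * d - 7))
    < 1 + 6 / (3 * d + 1)"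
proof -
  \<comment> \<open>Shifting to the smallest admissible d turns the cleared inequality into a
    polynomial with positive coefficients.\<close>
  define j where "j = d - 12"
  have j: "j \<ge> 0" "d = 12 + j" using assms by (auto simp: j_def)
  define D where "D = d ^ 3 - 3 * d\<^sup>2 - 3 * d - 7"
  have "D = j ^ 3 + 33 * j\<^sup>2 + 357 * j + 1253"
    unfolding D_def j(2) by (simp add: algebra_simps power2_eq_square power3_eq_cube)
  then have D: "D > 0" using j(1) by (simp add: add_nonneg_pos)
  have pos: "d > 0" "d - 1 > 0" "3 * d + 1 > 0" using assms by auto
  have "(3 * d + 7) * (d * (d - 1)) * D
      - (3 * d + 1) * ((d - 4) * (d + 1) * D + 4 * ((d - 3) * (d + 1)) * (d * (d - 1)))
      = 4772 + 10096 * j + 2152 * j\<^sup>2 + 160 * j ^ 3 + 4 * j ^ 4"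
    unfolding D_def j(2) by (simp add: algebra_simps power2_eq_square power3_eq_cube power4_eq_xxxx)
  also have "\<dots> > 0" using j(1) by (simp add: add_pos_nonneg)
  finally have num: "(3 * d + 1) * ((d - 4) * (d + 1) * D + 4 * ((d - 3) * (d + 1)) * (d * (d - 1)))
      < (3 * d + 7) * (d * (d - 1)) * D" by simp
  have "(d - 4) * ((d + 1) / (d * (d - 1))) + 4 * ((d - 3) * (d + 1) / D)
      = ((d - 4) * (d + 1) * D + 4 * ((d - 3) * (d + 1)) * (d * (d - 1))) / (d * (d - 1) * D)"
    using D pos by (simp add: add_frac_eq)
  also have "\<dots> < (3 * d + 7) / (3 * d + 1)"
    using num D pos by (simp add: frac_less_eq divide_less_eq less_divide_eq mult_ac)
  also have "\<dots> = 1 + 6 / (3 * d + 1)" using pos by (simp add: field_simps)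
  finally show ?thesis by (simp add: D_def)
qed

section \<open>Test vectors for non-extremal graphs\<close>

context theta_free_graph
begin

lemma sum_nbrs_nbr:
  fixes x :: "'a \<Rightarrow> real"
  assumes "u \<in> nbrs v"
  shows "(\<Sum>w\<in>nbrs u. x w) = x v + (\<Sum>w\<in>nbrs u \<inter> nbrs v. x w) + (\<Sum>w\<in>nbrs u \<inter> far v. x w)"
proof -
  have eq: "insert v ((nbrs u \<inter> nbrs v) \<union> (nbrs u \<inter> far v)) = nbrs u"
    using assms nbr_sym[of v u] nbrs_subset by (auto simp: far_def)
  have "v \<notin> (nbrs u \<inter> nbrs v) \<union> (nbrs u \<inter> far v)" using nbr_neq[of v v] by (auto simp: far_def)
  then have "(\<Sum>w\<in>nbrs u. x w) = x v + (\<Sum>w\<in>(nbrs u \<inter> nbrs v) \<union> (nbrs u \<inter> far v). x w)"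
    by (subst eq[symmetric], subst sum.insert) auto
  also have "(\<Sum>w\<in>(nbrs u \<inter> nbrs v) \<union> (nbrs u \<inter> far v). x w)
      = (\<Sum>w\<in>nbrs u \<inter> nbrs v. x w) + (\<Sum>w\<in>nbrs u \<inter> far v. x w)"
    by (intro sum.union_disjoint) (auto simp: far_def)
  finally show ?thesis by simp
qed

lemma nbrs_in_nbrs_triangle:
  assumes "u \<in> nbrs v" shows "nbrs u \<inter> nbrs v \<subseteq> triangle_nbrs v"
  using assms nbr_sym by (fastforce simp: triangle_nbrs_def)

lemma nontriangle_nbrs:
  assumes "u \<in> nbrs v - triangle_nbrs v" shows "nbrs u \<inter> nbrs v = {}"
  using assms by (auto simp: triangle_nbrs_def)

lemma triangle_partner:
  assumes "u \<in> triangle_nbrs v"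
  obtains u' where "nbrs u \<inter> nbrs v = {u'}" "u' \<in> triangle_nbrs v"
proof -
  have "u \<in> nbrs v" using assms triangle_nbrs_subset by blast
  then have "card (nbrs u \<inter> nbrs v) = 1" using card_nbrs_in_nbrs assms by simp
  then obtain u' where "nbrs u \<inter> nbrs v = {u'}" by (auto simp: card_1_singleton_iff)
  then show ?thesis using that nbrs_in_nbrs_triangle[OF \<open>u \<in> nbrs v\<close>] by blast
qed

lemma inner_zero_triangle:
  assumes "inner v = 0" "u \<in> triangle_nbrs v"
  shows "nbrs u \<inter> far v = {}"
  using inner_zero(2)[OF assms(1)] assms(2) nbr_sym by blast

lemma cross_nontriangle_sum:
  assumes "\<And>u. u \<in> triangle_nbrs v \<Longrightarrow> nbrs u \<inter> far v = {}"
  shows "cross v = (\<Sum>u\<in>nbrs v - triangle_nbrs v. card (nbrs u \<inter> far v))"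
  unfolding cross_def
  by (rule sum.mono_neutral_right) (use assms in auto)

text \<open>Each neighbour off the triangles contributes at least one cross edge; a total equal to
  their number leaves exactly one for each.\<close>

lemma cross_one:
  assumes tri: "\<And>u. u \<in> triangle_nbrs v \<Longrightarrow> nbrs u \<inter> far v = {}"
    and "cross v = deg v - card (triangle_nbrs v)"
    and u: "u \<in> nbrs v - triangle_nbrs v"
  shows "card (nbrs u \<inter> far v) = 1"
proof (rule ccontr)
  let ?S = "nbrs v - triangle_nbrs v"
  assume "card (nbrs u \<inter> far v) \<noteq> 1"
  then have "1 < card (nbrs u \<inter> far v)" using cross_nontriangle[OF u] by simp
  then have "(\<Sum>u\<in>?S. 1) < (\<Sum>u\<in>?S. card (nbrs u \<inter> far v))"
    using cross_nontriangle u by (intro sum_strict_mono_ex1) auto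
  moreover have "(\<Sum>u\<in>?S. 1) = deg v - card (triangle_nbrs v)"
    using card_Diff_subset[OF _ triangle_nbrs_subset, of v] by simp
  ultimately show False using assms(2) cross_nontriangle_sum[OF tri] by simp
qed

lemma card_far_le:
  assumes "inner v = 0" shows "2 * card (far v) \<le> cross v"
proof -
  have "2 * card (far v) = (\<Sum>w\<in>far v. 2)" by simp
  also have "\<dots> \<le> (\<Sum>w\<in>far v. card (nbrs w \<inter> nbrs v))"
    using far_deg_ge inner_zero(1)[OF assms] by (intro sum_mono) fastforce
  finally show ?thesis by (simp add: cross_far)
qed

text \<open>Lowering every neighbour to the weight 2 brings the quotient at \<open>v\<close> down to
  exactly deg v + 2 = 2k+1. The other vertices have room: neighbours have degree at most 3 and
  quotient at most (deg v + 10)/2, far vertices at most 6.\<close>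

lemma odd_indep_weight:
  assumes v: "v \<in> V" "deg v = 2 * k - 1" "card (triangle_nbrs v) = 2 * (k - 2)"
    and c: "cross v = 5" "inner v = 0"
  shows "\<exists>x. \<forall>u\<in>V. x u > 0 \<and> Q_apply x u < q_lower k * x u"
proof -
  define x :: "'a \<Rightarrow> real" where "x u = (if u = v then deg v else 2)" for u
  let ?L = "q_lower k"
  have L: "real (deg v) + 2 < ?L" using q_lower_gt[of k] v(2) k6 by simp
  have vN: "v \<notin> nbrs v" using nbr_neq[of v v] by auto
  have cardS: "card (nbrs v - triangle_nbrs v) = 3"
    using card_Diff_subset[OF _ triangle_nbrs_subset, of v] v k6 by simp
  have W2: "card (far v) \<le> 2" using card_far_le[OF c(2)] c(1) by simp
  have "Q_apply x u < ?L * x u" if u: "u \<in> V" for u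
  proof -
    consider "u = v" | "u \<in> nbrs v" | "u \<in> far v" using u by (auto simp: far_def)
    then show ?thesis
    proof cases
      case 1
      have "(\<Sum>w\<in>nbrs v. x w) = (\<Sum>w\<in>nbrs v. 2)"
        using vN by (intro sum.cong) (auto simp: x_def)
      then have "Q_apply x v = deg v * (deg v + 2)" by (simp add: Q_apply_def x_def algebra_simps)
      also have "\<dots> = (real (deg v) + 2) * real (deg v)" by (simp add: algebra_simps)
      also have "\<dots> < ?L * deg v" using v(2) k6 by (intro mult_strict_right_mono[OF L]) simp
      finally show ?thesis using 1 by (simp add: x_def)
    next
      case 2
      have "card (nbrs u \<inter> far v) \<le> card (far v)" by (intro card_mono) auto
      then have "deg u \<le> 3"
        using deg_nbr[OF 2] W2 inner_zero_triangle[OF c(2), of u] by (auto split: if_splits)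
      have vu: "v \<in> nbrs u" using 2 nbr_sym by auto
      have "(\<Sum>w\<in>nbrs u. x w) = x v + (\<Sum>w\<in>nbrs u - {v}. x w)"
        using vu by (simp add: sum.remove)
      also have "(\<Sum>w\<in>nbrs u - {v}. x w) = (\<Sum>w\<in>nbrs u - {v}. 2)"
        by (intro sum.cong) (auto simp: x_def)
      also have "\<dots> \<le> 4" using vu \<open>deg u \<le> 3\<close> by (simp add: card_Diff_singleton)
      finally have "Q_apply x u \<le> 3 * 2 + (deg v + 4)"
        using 2 vN \<open>deg u \<le> 3\<close> by (auto simp: Q_apply_def x_def)
      also have "\<dots> < ?L * 2" using L v(2) k6 by simp
      finally show ?thesis using 2 vN by (auto simp: x_def)
    next
      case 3
      have sub: "nbrs u \<subseteq> nbrs v - triangle_nbrs v" by (rule inner_zero(2)[OF c(2) 3])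
      then have "deg u \<le> 3" using card_mono[OF _ sub] cardS by simp
      moreover have "(\<Sum>w\<in>nbrs u. x w) = (\<Sum>w\<in>nbrs u. 2)"
        using sub vN by (intro sum.cong) (auto simp: x_def)
      ultimately have "Q_apply x u \<le> 12" using 3 by (simp add: Q_apply_def x_def far_def)
      also have "\<dots> < ?L * 2" using L v(2) k6 by simp
      finally show ?thesis using 3 by (simp add: x_def far_def)
    qed
  qed
  moreover have "x u > 0" for u using v(2) k6 by (simp add: x_def)
  ultimately show ?thesis by blast
qed

text \<open>Constant weights on the neighbours do not distinguish triangle neighbours from the other
  four, so the weights imitate an eigenvector: each class satisfies its own equation for a value
  slightly below \<open>q_lower k\<close>, and only the equation at \<open>v\<close> is left to
  \<open>even_indep_estimate\<close>.\<close>

lemma even_indep_weight: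
  assumes v: "v \<in> V" "deg v = 2 * k" "card (triangle_nbrs v) = 2 * (k - 2)"
    and c: "cross v = 4" "inner v = 0"
  shows "\<exists>x. \<forall>u\<in>V. x u > 0 \<and> Q_apply x u < q_lower k * x u"
proof -
  define d where "d = 2 * real k"
  let ?L = "q_lower k"
  have d: "d \<ge> 12" using k6 by (simp add: d_def)
  have "6 / (3 * d + 1) > 2 / (d + 1)" using d by (simp add: field_simps)
  then have L: "?L > d + 1 + 2 / (d + 1)" by (simp add: q_lower_def d_def)
  have L1: "?L > d + 1" using q_lower_gt[of k] by (simp add: d_def)
  \<comment> \<open>The eigenvalue equations away from \<open>v\<close>, solved for a value between \<open>d + 1\<close> and \<open>q_lower k\<close>.\<close>
  define s y z where "s = 4 / (d - 3)" and "y = 1 / (d - 2 + 2 / (d + 1))"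
    and "z = 1 / (d - 1 - s + 2 / (d + 1))"
  have s: "0 < s" "s < 1" using d by (auto simp: s_def)
  have y: "y > 0" and z: "z > 0" using d s by (auto simp: y_def z_def add_pos_pos)
  define x :: "'a \<Rightarrow> real" where
    "x u = (if u = v then 1 else if u \<in> triangle_nbrs v then y
      else if u \<in> nbrs v then z else s * z)" for u
  have vN: "v \<notin> nbrs v" using nbr_neq[of v v] by auto
  have T: "triangle_nbrs v \<subseteq> nbrs v" by (rule triangle_nbrs_subset)
  have cardS: "card (nbrs v - triangle_nbrs v) = 4"
    using card_Diff_subset[OF _ T] v k6 by simp
  have xT: "x u = y" if "u \<in> triangle_nbrs v" for u using that T vN by (auto simp: x_def)
  have xS: "x u = z" if "u \<in> nbrs v - triangle_nbrs v" for u using that vN by (auto simp: x_def)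
  have xF: "x u = s * z" if "u \<in> far v" for u using that T by (auto simp: x_def far_def)
  have xv: "x v = 1" by (simp add: x_def)
  have tri: "nbrs u \<inter> far v = {}" if "u \<in> triangle_nbrs v" for u
    by (rule inner_zero_triangle[OF c(2) that])
  have "Q_apply x u < ?L * x u" if u: "u \<in> V" for u
  proof -
    consider "u = v" | "u \<in> triangle_nbrs v" | "u \<in> nbrs v - triangle_nbrs v" | "u \<in> far v"
      using u by (auto simp: far_def)
    then show ?thesis
    proof cases
      case 1
      have "(\<Sum>w\<in>nbrs v. x w) = (\<Sum>w\<in>nbrs v - triangle_nbrs v. x w) + (\<Sum>w\<in>triangle_nbrs v. x w)"
        using sum.subset_diff[OF T, of x] by simp
      also have "\<dots> = 4 * z + (d - 4) * y"
        using xT xS cardS v(3) k6 by (simp add: d_def of_nat_diff)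
      \<comment> \<open>The auxiliary offset 2/(d+1) is chosen for this closed form: d - 2 + 2/(d+1)
        = d(d-1)/(d+1).\<close>
      also have "y = (d + 1) / (d * (d - 1))"
        using d by (simp add: y_def field_simps)
      also have "z = (d - 3) * (d + 1) / (d ^ 3 - 3 * d\<^sup>2 - 3 * d - 7)"
      proof -
        have "d - 1 - s + 2 / (d + 1) = (d ^ 3 - 3 * d\<^sup>2 - 3 * d - 7) / ((d - 3) * (d + 1))"
          using d by (simp add: s_def field_simps power2_eq_square power3_eq_cube)
        then show ?thesis by (simp add: z_def)
      qed
      finally have "(\<Sum>w\<in>nbrs v. x w) < 1 + 6 / (3 * d + 1)"
        using even_indep_estimate[OF d] by simp
      then show ?thesis using 1 xv v(2) by (simp add: Q_apply_def q_lower_def d_def)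
    next
      case 2
      then obtain u' where u': "nbrs u \<inter> nbrs v = {u'}" "u' \<in> triangle_nbrs v"
        by (rule triangle_partner)
      have uN: "u \<in> nbrs v" using 2 T by blast
      have "deg u = 2" using deg_nbr[OF uN] tri[OF 2] 2 by simp
      moreover have "(\<Sum>w\<in>nbrs u. x w) = 1 + y"
        using sum_nbrs_nbr[OF uN, of x] u' tri[OF 2] xT xv by simp
      ultimately have "Q_apply x u = 1 + 3 * y" using xT[OF 2] by (simp add: Q_apply_def)
      moreover have "1 < (?L - 3) * y"
      proof -
        have "1 = (d - 2 + 2 / (d + 1)) * y" using d y by (simp add: y_def)
        also have "\<dots> < (?L - 3) * y" using L y by (intro mult_strict_right_mono) auto
        finally show ?thesis .
      qed
      ultimately show ?thesis using xT[OF 2] by (simp add: algebra_simps)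
    next
      case 3
      have one: "card (nbrs u \<inter> far v) = 1" using cross_one[OF tri _ 3] c(1) v k6 by simp
      then obtain w where w: "nbrs u \<inter> far v = {w}" by (auto simp: card_1_singleton_iff)
      have uN: "u \<in> nbrs v" using 3 by blast
      have "deg u = 2" using deg_nbr[OF uN] one 3 by simp
      moreover have "(\<Sum>w\<in>nbrs u. x w) = 1 + s * z"
        using sum_nbrs_nbr[OF uN, of x] w nontriangle_nbrs[OF 3] xF[of w] xv by auto
      ultimately have "Q_apply x u = 1 + (2 + s) * z" using xS[OF 3]
        by (simp add: Q_apply_def algebra_simps)
      moreover have "1 < (?L - 2 - s) * z"
      proof -
        have "1 = (d - 1 - s + 2 / (d + 1)) * z" using z by (simp add: z_def)
        also have "\<dots> < (?L - 2 - s) * z" using L z by (intro mult_strict_right_mono) auto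
        finally show ?thesis .
      qed
      ultimately show ?thesis using xS[OF 3] by (simp add: algebra_simps)
    next
      case 4
      have sub: "nbrs u \<subseteq> nbrs v - triangle_nbrs v" by (rule inner_zero(2)[OF c(2) 4])
      then have "deg u \<le> 4" using card_mono[OF _ sub] cardS by simp
      moreover have "(\<Sum>w\<in>nbrs u. x w) = deg u * z"
        using sub xS by (simp add: subset_iff)
      then have "Q_apply x u = deg u * (s * z + z)"
        using xF[OF 4] by (simp add: Q_apply_def algebra_simps)
      moreover have "real (deg u) * (s * z + z) \<le> 4 * (s * z + z)"
        using s z \<open>deg u \<le> 4\<close> by (intro mult_right_mono) auto
      ultimately have "Q_apply x u \<le> 4 * (s * z + z)" by simp
      also have "\<dots> < ?L * (s * z)"
      proof -
        \<comment> \<open>The origin of \<open>s\<close>: a far vertex may be adjacent to all four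
          neighbours off the triangles, which requires 4(s + 1) < \<open>?L\<close> s, and
          \<open>?L\<close> exceeds d + 1.\<close>
        have "4 = s * (d - 3)" using d by (simp add: s_def field_simps)
        also have "\<dots> < s * (?L - 4)" using s L1 by simp
        finally have "4 * z < s * (?L - 4) * z" using z by simp
        then show ?thesis by (simp add: algebra_simps)
      qed
      finally show ?thesis using xF[OF 4] by simp
    qed
  qed
  moreover have "x u > 0" for u using s y z by (simp add: x_def)
  ultimately show ?thesis by blast
qed

text \<open>One vector has to work at all vertices at once, so a single vertex of either independent
  type replaces the degree vector globally by the vector built around it.\<close>

lemma strict_weight:
  assumes "\<And>v. v \<in> V \<Longrightarrow>
    \<not> (deg v = 2 * k \<and> card (triangle_nbrs v) = 2 * (k - 1) \<and> cross v = 2 \<and> inner v = 1 \<and> card (far v) = 2)"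
  shows "\<exists>x. \<forall>u\<in>V. x u > 0 \<and> Q_apply x u < q_lower k * x u"
proof (cases "\<exists>v\<in>V. inner v = 0 \<and> card (triangle_nbrs v) = 2 * (k - 2)
    \<and> (deg v = 2 * k \<and> cross v = 4 \<or> deg v = 2 * k - 1 \<and> cross v = 5)")
  case True
  then obtain v where v: "v \<in> V" "inner v = 0" "card (triangle_nbrs v) = 2 * (k - 2)"
    and "deg v = 2 * k \<and> cross v = 4 \<or> deg v = 2 * k - 1 \<and> cross v = 5" by auto
  then show ?thesis
    using even_indep_weight[OF v(1) _ v(3) _ v(2)] odd_indep_weight[OF v(1) _ v(3) _ v(2)] by auto
next
  case False
  let ?L = "q_lower k"
  have "Q_apply (\<lambda>u. real (deg u)) v < ?L * deg v" if v: "v \<in> V" for v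
    using v
  proof (cases rule: vertex_cases)
    case small
    have "Q_apply (\<lambda>u. real (deg u)) v = real (deg v * deg v + (\<Sum>u\<in>nbrs v. deg u))"
      by (simp add: Q_apply_def)
    also have "\<dots> \<le> real ((2 * k + 1) * deg v)" using small by (rule of_nat_mono)
    also have "\<dots> = (2 * real k + 1) * real (deg v)" by (simp add: algebra_simps)
    also have "\<dots> < ?L * deg v"
      using min_deg[OF v] by (intro mult_strict_right_mono[OF q_lower_gt]) simp
    finally show ?thesis .
  next
    case near
    have d: "real (deg v) = 2 * real k - 1" using near(1) k6 by simp
    have "real (\<Sum>u\<in>nbrs v. deg u) \<le> real (4 * k - 1)" using near(2) by (rule of_nat_mono)
    then have "Q_apply (\<lambda>u. real (deg u)) v \<le> (2 * real k - 1) * (2 * real k - 1) + (4 * real k - 1)"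
      using k6 by (simp add: Q_apply_def d of_nat_diff)
    also have "\<dots> < ?L * (2 * real k - 1)"
    proof -
      have "1 < 6 / (6 * real k + 1) * (2 * real k - 1)" using k6 by (simp add: field_simps)
      then show ?thesis by (simp add: q_lower_def algebra_simps)
    qed
    finally show ?thesis by (simp add: d)
  next
    case even_indep
    then show ?thesis using False v by blast
  next
    case odd_indep
    then show ?thesis using False v by blast
  next
    case extremal
    then show ?thesis using assms[OF v] by blast
  qed
  moreover have "real (deg v) > 0" if "v \<in> V" for v using min_deg[OF that] by simp
  ultimately show ?thesis by (intro exI[of _ "\<lambda>u. real (deg u)"]) simp
qed

end

section \<open>Isomorphism and containment\<close>

text \<open>Removing one orbit of the involution at a time puts partners at 2i-1 and 2i, the labels
  of a triangle in \<open>friendship_graph\<close>. Only the image of \<open>g\<close> is recorded,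
  since injectivity later follows from cardinalities.\<close>

lemma pairing_enumeration:
  assumes "finite T" "card T = 2 * n"
    and "\<And>u. u \<in> T \<Longrightarrow> \<sigma> u \<in> T \<and> \<sigma> u \<noteq> u \<and> \<sigma> (\<sigma> u) = u"
  shows "\<exists>g. g ` {1..2 * n} = T \<and> (\<forall>i\<in>{1..n}. g (2 * i) = \<sigma> (g (2 * i - 1)))"
  using assms
proof (induction n arbitrary: T)
  case 0
  then show ?case by simp
next
  case (Suc n)
  from Suc.prems(2) obtain u where u: "u \<in> T" by fastforce
  have s: "\<sigma> u \<in> T" "\<sigma> u \<noteq> u" "\<sigma> (\<sigma> u) = u" using Suc.prems(3)[OF u] by auto
  let ?T = "T - {u, \<sigma> u}"
  have "card ?T = 2 * n" using Suc.prems(1,2) u s by (simp add: card_Diff_subset)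
  moreover have "\<sigma> w \<in> ?T \<and> \<sigma> w \<noteq> w \<and> \<sigma> (\<sigma> w) = w" if "w \<in> ?T" for w
    using Suc.prems(3)[of w] that s by auto
  ultimately obtain g where g: "g ` {1..2 * n} = ?T" "\<forall>i\<in>{1..n}. g (2 * i) = \<sigma> (g (2 * i - 1))"
    using Suc.IH[of ?T] Suc.prems(1) by blast
  define h where "h = g(2 * n + 1 := u, 2 * n + 2 := \<sigma> u)"
  have old: "h i = g i" if "i \<le> 2 * n" for i using that by (simp add: h_def)
  have "{1..2 * Suc n} = {1..2 * n} \<union> {2 * n + 1, 2 * n + 2}" by auto
  then have "h ` {1..2 * Suc n} = h ` {1..2 * n} \<union> {u, \<sigma> u}" 
    by (simp only: image_Un image_insert image_empty) (simp add: h_def)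
  also have "h ` {1..2 * n} = ?T" using old g(1) by (metis (no_types, lifting) atLeastAtMost_iff image_cong)
  finally have "h ` {1..2 * Suc n} = T" using u s by auto
  moreover have "h (2 * i) = \<sigma> (h (2 * i - 1))" if "i \<in> {1..Suc n}" for i
  proof (cases "i = Suc n")
    case True
    then show ?thesis by (simp add: h_def)
  next
    case False
    then have "i \<in> {1..n}" using that by simp
    moreover from this have "2 * i \<le> 2 * n" "2 * i - 1 \<le> 2 * n" by auto
    ultimately show ?thesis using g(2) old by simp
  qed
  ultimately show ?case by blast
qed

text \<open>Tails and heads are the projections on both sides, so the arc map of a digraph
  isomorphism is determined by its vertex map.\<close>

lemma isomorphic_iff:
  assumes "parcs G \<subseteq> pverts G \<times> pverts G"
  shows "isomorphic G H \<longleftrightarrow> (\<exists>\<phi>. inj_on \<phi> (pverts G) \<and> pverts H = \<phi> ` pverts G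
    \<and> parcs H = map_prod \<phi> \<phi> ` parcs G)"
proof
  assume "isomorphic G H"
  then obtain h where h: "pre_digraph.digraph_isomorphism (with_proj G) h"
    and H: "with_proj H = app_iso h (with_proj G)"
    by (auto simp: isomorphic_def digraph_iso_def)
  have verts: "pverts H = iso_verts h ` pverts G" and arcs: "parcs H = iso_arcs h ` parcs G"
    and tail: "iso_tail h = fst" and head: "iso_head h = snd"
    using arg_cong[OF H, of verts] arg_cong[OF H, of arcs]
      arg_cong[OF H, of tail] arg_cong[OF H, of head] by auto
  have "iso_arcs h e = map_prod (iso_verts h) (iso_verts h) e" if "e \<in> parcs G" for e
    using h that by (auto simp: pre_digraph.digraph_isomorphism_def tail head prod_eq_iff)
  then have "parcs H = map_prod (iso_verts h) (iso_verts h) ` parcs G"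
    unfolding arcs by (intro image_cong) auto
  then show "\<exists>\<phi>. inj_on \<phi> (pverts G) \<and> pverts H = \<phi> ` pverts G \<and> parcs H = map_prod \<phi> \<phi> ` parcs G"
    using h verts by (auto simp: pre_digraph.digraph_isomorphism_def)
next
  assume "\<exists>\<phi>. inj_on \<phi> (pverts G) \<and> pverts H = \<phi> ` pverts G \<and> parcs H = map_prod \<phi> \<phi> ` parcs G"
  then obtain \<phi> where \<phi>: "inj_on \<phi> (pverts G)" "pverts H = \<phi> ` pverts G"
    "parcs H = map_prod \<phi> \<phi> ` parcs G" by blast
  define h :: "('a, 'a \<times> 'a, 'b, 'b \<times> 'b) digraph_isomorphism" where
    "h = \<lparr>iso_verts = \<phi>, iso_arcs = map_prod \<phi> \<phi>, iso_head = snd, iso_tail = fst\<rparr>"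
  have "wf_digraph (with_proj G)" using assms by unfold_locales auto
  moreover have "inj_on (map_prod \<phi> \<phi>) (parcs G)"
    using map_prod_inj_on[OF \<phi>(1) \<phi>(1)] assms inj_on_subset by blast
  ultimately have "pre_digraph.digraph_isomorphism (with_proj G) h"
    using \<phi>(1) by (simp add: pre_digraph.digraph_isomorphism_def h_def)
  moreover have "with_proj H = app_iso h (with_proj G)"
    by (simp add: with_proj_def app_iso_def h_def \<phi>)
  ultimately show "isomorphic G H" by (auto simp: isomorphic_def digraph_iso_def)
qed

text \<open>Subgraphs need not be induced, so the image of \<open>F\<close> itself is the required
  subgraph.\<close>

lemma contains_if_inj_hom:
  assumes F: "parcs F \<subseteq> pverts F \<times> pverts F" and G: "parcs G \<subseteq> pverts G \<times> pverts G"
    and "inj_on \<phi> (pverts F)" "\<phi> ` pverts F \<subseteq> pverts G" "map_prod \<phi> \<phi> ` parcs F \<subseteq> parcs G"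
  shows "contains G F"
proof -
  define H where "H = \<lparr>pverts = \<phi> ` pverts F, parcs = map_prod \<phi> \<phi> ` parcs F\<rparr>"
  have "wf_digraph (with_proj G)" using G by unfold_locales auto
  moreover have "wf_digraph (with_proj H)" using F by unfold_locales (auto simp: H_def)
  ultimately have "subgraph (with_proj H) (with_proj G)"
    using assms(4,5) by (simp add: subgraph_def H_def compatibleI_with_proj)
  moreover have "isomorphic F H"
    unfolding isomorphic_iff[OF F] using assms(3) by (auto simp: H_def)
  ultimately show ?thesis by (auto simp: contains_def)
qed

section \<open>Theta graphs as subgraphs\<close>

lemma pverts_theta_graph:
  "pverts (theta_graph ls) = {theta_vertex ls i j | i j. i < length ls \<and> j \<le> ls ! i}"
  by (simp add: theta_graph_def)

lemma parcs_theta_graph: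
  "parcs (theta_graph ls) = (\<Union>i<length ls. \<Union>j<ls ! i.
    {(theta_vertex ls i j, theta_vertex ls i (Suc j)), (theta_vertex ls i (Suc j), theta_vertex ls i j)})"
proof -
  have "{(theta_vertex ls i j, theta_vertex ls i (Suc j)) | i j. i < length ls \<and> j < ls ! i}
      = (\<Union>i<length ls. \<Union>j<ls ! i. {(theta_vertex ls i j, theta_vertex ls i (Suc j))})"
    by auto
  then show ?thesis by (simp add: theta_graph_def parcs_mk_symmetric)
qed

lemma contains_theta_graph:
  assumes G: "simple_graph (pverts G) (parcs G)"
    and inj: "inj_on \<phi> (pverts (theta_graph ls))"
    and path: "\<And>i j. i < length ls \<Longrightarrow> j < ls ! i \<Longrightarrow>
      (\<phi> (theta_vertex ls i j), \<phi> (theta_vertex ls i (Suc j))) \<in> parcs G"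
    and pos: "\<And>i. i < length ls \<Longrightarrow> ls ! i > 0"
  shows "contains G (theta_graph ls)"
proof (rule contains_if_inj_hom[OF _ _ inj])
  interpret simple_graph "pverts G" "parcs G" by (rule G)
  show "parcs G \<subseteq> pverts G \<times> pverts G" by (rule R_subset)
  show "parcs (theta_graph ls) \<subseteq> pverts (theta_graph ls) \<times> pverts (theta_graph ls)"
    unfolding parcs_theta_graph pverts_theta_graph by (fastforce intro: less_imp_le)
  show "map_prod \<phi> \<phi> ` parcs (theta_graph ls) \<subseteq> parcs G"
    unfolding parcs_theta_graph using path nbr_sym[OF path] by auto
  show "\<phi> ` pverts (theta_graph ls) \<subseteq> pverts G"
  proof
    fix v assume "v \<in> \<phi> ` pverts (theta_graph ls)"
    then obtain i j where ij: "i < length ls" "j \<le> ls ! i" "v = \<phi> (theta_vertex ls i j)"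
      by (auto simp: pverts_theta_graph)
    show "v \<in> pverts G"
    proof (cases j)
      case 0
      then show ?thesis using path[of i 0] pos[of i] ij R_subset by auto
    next
      case (Suc j')
      then show ?thesis using path[of i j'] ij R_subset by auto
    qed
  qed
qed

lemma contains_theta_122:
  assumes G: "simple_graph (pverts G) (parcs G)"
    and arcs: "(a, b) \<in> parcs G" "(a, c) \<in> parcs G" "(c, b) \<in> parcs G" "(a, d) \<in> parcs G" "(d, b) \<in> parcs G"
    and "c \<noteq> d"
  shows "contains G (theta_graph [1, 2, 2])"
proof -
  interpret simple_graph "pverts G" "parcs G" by (rule G)
  \<comment> \<open>Path \<open>i\<close> labels its inner vertices \<open>(Suc i, j)\<close>: the
    path of length 1 has none, and the midpoints of the other two are \<open>(2, 1)\<close> and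
    \<open>(3, 1)\<close>.\<close>
  define \<phi> :: "nat \<times> nat \<Rightarrow> 'a" where
    "\<phi> p = (if p = (0, 0) then a else if p = (0, 1) then b else if p = (2, 1) then c else d)" for p
  have "distinct [a, b, c, d]" using arcs \<open>c \<noteq> d\<close> nbr_neq by fastforce
  then have inj: "inj_on \<phi> {(0, 0), (0, 1), (2, 1), (3, 1)}" by (auto simp: inj_on_def \<phi>_def)
  let ?ls = "[1, 2, 2] :: nat list"
  show ?thesis
  proof (rule contains_theta_graph[OF G])
    show "inj_on \<phi> (pverts (theta_graph ?ls))"
    proof (rule inj_on_subset[OF inj], rule subsetI)
      fix p assume "p \<in> pverts (theta_graph ?ls)"
      then have "\<exists>i j. p = theta_vertex ?ls i j \<and> i < length ?ls \<and> j \<le> ?ls ! i"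
        by (simp only: pverts_theta_graph mem_Collect_eq)
      then obtain i j where ij: "i < length ?ls" "j \<le> ?ls ! i" and p: "p = theta_vertex ?ls i j"
        by (elim exE conjE)
      from ij(1) consider "i = 0" | "i = 1" | "i = 2" by fastforce
      then show "p \<in> {(0, 0), (0, 1), (2, 1), (3, 1)}"
        by cases (use ij(2) in \<open>auto simp: p theta_vertex_def\<close>)
    qed
  next
    fix i j :: nat assume "i < length ?ls" and j: "j < ?ls ! i"
    then consider "i = 0" | "i = 1" | "i = 2" by fastforce
    then show "(\<phi> (theta_vertex ?ls i j), \<phi> (theta_vertex ?ls i (Suc j))) \<in> parcs G"
      by cases (use j arcs in \<open>auto simp: theta_vertex_def \<phi>_def less_Suc_eq numeral_eq_Suc\<close>)
  next
    fix i :: nat assume "i < length ?ls"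
    then consider "i = 0" | "i = 1" | "i = 2" by fastforce
    then show "?ls ! i > 0" by cases auto
  qed
qed

lemma contains_theta_123:
  assumes G: "simple_graph (pverts G) (parcs G)"
    and arcs: "(a, b) \<in> parcs G" "(a, c) \<in> parcs G" "(c, b) \<in> parcs G"
      "(a, d) \<in> parcs G" "(d, e) \<in> parcs G" "(e, b) \<in> parcs G"
    and neq: "d \<noteq> b" "d \<noteq> c" "e \<noteq> a" "e \<noteq> c"
  shows "contains G (theta_graph [1, 2, 3])"
proof -
  interpret simple_graph "pverts G" "parcs G" by (rule G)
  define \<phi> :: "nat \<times> nat \<Rightarrow> 'a" where
    "\<phi> p = (if p = (0, 0) then a else if p = (0, 1) then b else if p = (2, 1) then c
      else if p = (3, 1) then d else e)" for p
  have "distinct [a, b, c, d, e]" using arcs neq nbr_neq by fastforce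
  then have inj: "inj_on \<phi> {(0, 0), (0, 1), (2, 1), (3, 1), (3, 2)}" by (auto simp: inj_on_def \<phi>_def)
  let ?ls = "[1, 2, 3] :: nat list"
  show ?thesis
  proof (rule contains_theta_graph[OF G])
    show "inj_on \<phi> (pverts (theta_graph ?ls))"
    proof (rule inj_on_subset[OF inj], rule subsetI)
      fix p assume "p \<in> pverts (theta_graph ?ls)"
      then have "\<exists>i j. p = theta_vertex ?ls i j \<and> i < length ?ls \<and> j \<le> ?ls ! i"
        by (simp only: pverts_theta_graph mem_Collect_eq)
      then obtain i j where ij: "i < length ?ls" "j \<le> ?ls ! i" and p: "p = theta_vertex ?ls i j"
        by (elim exE conjE)
      from ij(1) consider "i = 0" | "i = 1" | "i = 2" by fastforce
      then show "p \<in> {(0, 0), (0, 1), (2, 1), (3, 1), (3, 2)}"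
        by cases (use ij(2) in \<open>auto simp: p theta_vertex_def\<close>)
    qed
  next
    fix i j :: nat assume "i < length ?ls" and j: "j < ?ls ! i"
    then consider "i = 0" | "i = 1" | "i = 2" by fastforce
    then show "(\<phi> (theta_vertex ?ls i j), \<phi> (theta_vertex ?ls i (Suc j))) \<in> parcs G"
      by cases (use j arcs in \<open>auto simp: theta_vertex_def \<phi>_def less_Suc_eq numeral_eq_Suc\<close>)
  next
    fix i :: nat assume "i < length ?ls"
    then consider "i = 0" | "i = 1" | "i = 2" by fastforce
    then show "?ls ! i > 0" by cases auto
  qed
qed

section \<open>The graph \<open>H\<^sub>p\<^sup>(\<^sup>5\<^sup>)\<close>\<close>

lemma pverts_H_graph:
  assumes "k \<ge> 1" shows "pverts (H_graph (2 * k - 1) 5) = {..<2 * k + 3}"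
proof -
  have "{..<5::nat} = {0, 1, 2, 3, 4}" by auto
  then have "H_vertex (2 * k - 1) ` {..<5} = {0, 2 * k - 1, 2 * k, 2 * k + 1, 2 * k + 2}"
    using assms by (auto simp: H_vertex_def)
  then show ?thesis
    using assms by (auto simp: H_graph_def friendship_graph_def cycle_graph_def)
qed

lemma parcs_friendship_graph:
  "(a, b) \<in> parcs (friendship_graph (2 * k - 1)) \<longleftrightarrow>
    (\<exists>i\<in>{1..k - 1}. {a, b} = {0, 2 * i - 1} \<or> {a, b} = {0, 2 * i} \<or> {a, b} = {2 * i - 1, 2 * i})"
proof -
  have "(2 * k - 1 - 1) div 2 = k - 1" by simp
  then show ?thesis
    by (simp add: friendship_graph_def parcs_mk_symmetric doubleton_eq_iff) blast
qed

lemma parcs_cycle_graph_5: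
  "parcs (cycle_graph 5) = {(0, 1), (1, 0), (1, 2), (2, 1), (2, 3), (3, 2), (3, 4), (4, 3), (4, 0), (0, 4)}"
proof -
  have "{..<5::nat} = {0, 1, 2, 3, 4}" by auto
  moreover have "{(i, Suc i mod 5) | i. i < 5} = (\<lambda>i. (i, Suc i mod 5)) ` {..<5}"
    by auto
  ultimately have "{(i, Suc i mod 5) | i. i < 5} = {(0, 1), (1, 2), (2, 3), (3, 4), (4, 0)}"
    by (simp add: numeral_2_eq_2)
  then show ?thesis by (simp only: cycle_graph_def parcs_mk_symmetric with_proj_simps pair_pre_digraph.simps) auto
qed

lemma parcs_H_graph:
  assumes "k \<ge> 1"
  shows "(a, b) \<in> parcs (H_graph (2 * k - 1) 5) \<longleftrightarrow>
    (\<exists>i\<in>{1..k - 1}. {a, b} = {0, 2 * i - 1} \<or> {a, b} = {0, 2 * i} \<or> {a, b} = {2 * i - 1, 2 * i})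
    \<or> {a, b} \<in> {{0, 2 * k - 1}, {2 * k - 1, 2 * k}, {2 * k, 2 * k + 1}, {2 * k + 1, 2 * k + 2}, {2 * k + 2, 0}}"
proof -
  have v: "H_vertex (2 * k - 1) 0 = 0" "H_vertex (2 * k - 1) 1 = 2 * k - 1"
    "H_vertex (2 * k - 1) 2 = 2 * k" "H_vertex (2 * k - 1) 3 = 2 * k + 1" "H_vertex (2 * k - 1) 4 = 2 * k + 2"
    using assms by (auto simp: H_vertex_def)
  have "(a, b) \<in> map_prod (H_vertex (2 * k - 1)) (H_vertex (2 * k - 1)) ` parcs (cycle_graph 5) \<longleftrightarrow>
    {a, b} \<in> {{0, 2 * k - 1}, {2 * k - 1, 2 * k}, {2 * k, 2 * k + 1}, {2 * k + 1, 2 * k + 2}, {2 * k + 2, 0}}"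
    unfolding parcs_cycle_graph_5 image_insert image_empty map_prod_simp v insert_iff empty_iff
      prod.inject doubleton_eq_iff by (simp only: disj_assoc simp_thms)
  then show ?thesis
    by (simp only: H_graph_def pair_pre_digraph.simps Un_iff parcs_friendship_graph)
qed

text \<open>The last disjunct is the path \<open>2k-1, 2k, 2k+1, 2k+2\<close> that the cycle leaves outside \<open>0\<close>.\<close>

definition H_arc :: "nat \<Rightarrow> nat \<Rightarrow> nat \<Rightarrow> bool" where
  "H_arc k a b \<longleftrightarrow> a = 0 \<and> 1 \<le> b \<and> b \<le> 2 * k - 1 \<or> a = 0 \<and> b = 2 * k + 2
    \<or> odd a \<and> a + 2 < 2 * k \<and> b = a + 1 \<or> 2 * k \<le> a + 1 \<and> a < 2 * k + 2 \<and> b = a + 1"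

text \<open>Replaces the quantified triangle index by order and parity conditions;
  \<open>(b + 1) div 2\<close> recovers the index from either of the labels 2i-1 and 2i.\<close>

lemma parcs_H_graph_iff:
  assumes "k \<ge> 1"
  shows "(a, b) \<in> parcs (H_graph (2 * k - 1) 5) \<longleftrightarrow> H_arc k a b \<or> H_arc k b a"
proof -
  have e1: "(\<exists>i\<in>{1..k - 1}. b = 2 * i - 1 \<or> b = 2 * i) \<longleftrightarrow> 1 \<le> b \<and> b + 2 \<le> 2 * k" for b
  proof
    assume "1 \<le> b \<and> b + 2 \<le> 2 * k"
    then have "(b + 1) div 2 \<in> {1..k - 1} \<and> (b = 2 * ((b + 1) div 2) - 1 \<or> b = 2 * ((b + 1) div 2))"
      unfolding atLeastAtMost_iff by presburger
    then show "\<exists>i\<in>{1..k - 1}. b = 2 * i - 1 \<or> b = 2 * i" by blast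
  qed auto
  have e2: "(\<exists>i\<in>{1..k - 1}. a = 2 * i - 1 \<and> b = 2 * i) \<longleftrightarrow> odd a \<and> a + 2 < 2 * k \<and> b = a + 1" for a b
  proof
    assume "odd a \<and> a + 2 < 2 * k \<and> b = a + 1"
    then have "(a + 1) div 2 \<in> {1..k - 1} \<and> a = 2 * ((a + 1) div 2) - 1 \<and> b = 2 * ((a + 1) div 2)"
      unfolding atLeastAtMost_iff by presburger
    then show "\<exists>i\<in>{1..k - 1}. a = 2 * i - 1 \<and> b = 2 * i" by blast
  qed auto
  have "(\<exists>i\<in>{1..k - 1}. {a, b} = {0, 2 * i - 1} \<or> {a, b} = {0, 2 * i} \<or> {a, b} = {2 * i - 1, 2 * i})
    \<longleftrightarrow> a = 0 \<and> (\<exists>i\<in>{1..k - 1}. b = 2 * i - 1 \<or> b = 2 * i) \<or> b = 0 \<and> (\<exists>i\<in>{1..k - 1}. a = 2 * i - 1 \<or> a = 2 * i)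
      \<or> (\<exists>i\<in>{1..k - 1}. a = 2 * i - 1 \<and> b = 2 * i) \<or> (\<exists>i\<in>{1..k - 1}. b = 2 * i - 1 \<and> a = 2 * i)"
    unfolding doubleton_eq_iff by blast
  also have "\<dots> \<longleftrightarrow> a = 0 \<and> 1 \<le> b \<and> b + 2 \<le> 2 * k \<or> b = 0 \<and> 1 \<le> a \<and> a + 2 \<le> 2 * k
      \<or> odd a \<and> a + 2 < 2 * k \<and> b = a + 1 \<or> odd b \<and> b + 2 < 2 * k \<and> a = b + 1"
    by (simp only: e1 e2)
  finally have arcs: "(a, b) \<in> parcs (H_graph (2 * k - 1) 5) \<longleftrightarrow> (\<dots>
      \<or> {a, b} \<in> {{0, 2 * k - 1}, {2 * k - 1, 2 * k}, {2 * k, 2 * k + 1}, {2 * k + 1, 2 * k + 2}, {2 * k + 2, 0}})"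
    by (simp only: parcs_H_graph[OF assms] disj_assoc)
  have c1: "a = 0 \<and> 1 \<le> b \<and> b \<le> 2 * k - 1 \<longleftrightarrow> a = 0 \<and> 1 \<le> b \<and> b + 2 \<le> 2 * k \<or> a = 0 \<and> b = 2 * k - 1"
    for a b :: nat using assms by auto
  have c2: "2 * k \<le> a + 1 \<and> a < 2 * k + 2 \<and> b = a + 1 \<longleftrightarrow>
      a = 2 * k - 1 \<and> b = 2 * k \<or> a = 2 * k \<and> b = 2 * k + 1 \<or> a = 2 * k + 1 \<and> b = 2 * k + 2"
    for a b :: nat using assms by auto
  show ?thesis
    unfolding arcs H_arc_def c1 c2 doubleton_eq_iff insert_iff empty_iff
    by (simp only: simp_thms disj_ac conj_ac)
qed

definition H_nbrs :: "nat \<Rightarrow> nat \<Rightarrow> nat set" where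
  "H_nbrs k j = parcs (H_graph (2 * k - 1) 5) `` {j}"

lemma H_nbrs_eq:
  assumes k: "k \<ge> 1"
  shows "H_nbrs k 0 = {1..2 * k - 1} \<union> {2 * k + 2}"
    and "i \<in> {1..k - 1} \<Longrightarrow> H_nbrs k (2 * i - 1) = {0, 2 * i}"
    and "i \<in> {1..k - 1} \<Longrightarrow> H_nbrs k (2 * i) = {0, 2 * i - 1}"
    and "H_nbrs k (2 * k - 1) = {0, 2 * k}"
    and "H_nbrs k (2 * k) = {2 * k - 1, 2 * k + 1}"
    and "H_nbrs k (2 * k + 1) = {2 * k, 2 * k + 2}"
    and "H_nbrs k (2 * k + 2) = {2 * k + 1, 0}"
proof -
  have S: "j \<in> H_nbrs k i \<longleftrightarrow> H_arc k i j \<or> H_arc k j i" for i j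
    unfolding H_nbrs_def Image_singleton_iff by (rule parcs_H_graph_iff[OF k])
  show "H_nbrs k 0 = {1..2 * k - 1} \<union> {2 * k + 2}"
    by (rule Set.set_eqI) (use k in \<open>auto simp: S H_arc_def\<close>)
  show "H_nbrs k (2 * k - 1) = {0, 2 * k}"
    by (rule Set.set_eqI) (use k in \<open>auto simp: S H_arc_def\<close>)
  show "H_nbrs k (2 * k) = {2 * k - 1, 2 * k + 1}"
    by (rule Set.set_eqI) (use k in \<open>auto simp: S H_arc_def\<close>)
  show "H_nbrs k (2 * k + 1) = {2 * k, 2 * k + 2}"
    by (rule Set.set_eqI) (use k in \<open>auto simp: S H_arc_def\<close>)
  show "H_nbrs k (2 * k + 2) = {2 * k + 1, 0}"
    by (rule Set.set_eqI) (use k in \<open>auto simp: S H_arc_def\<close>)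
  assume "i \<in> {1..k - 1}"
  then have i: "1 \<le> i" "i + 1 \<le> k" "odd (2 * i - 1)" by auto
  \<comment> \<open>Removes the truncated subtraction in \<open>2 * i - 1\<close>.\<close>
  obtain l where l: "i = Suc l" using i(1) by (cases i) auto
  have "H_nbrs k (2 * l + 1) = {0, 2 * l + 2}"
    by (rule Set.set_eqI) (use i l in \<open>auto simp: S H_arc_def\<close>)
  then show "H_nbrs k (2 * i - 1) = {0, 2 * i}" by (simp add: l)
  show "H_nbrs k (2 * i) = {0, 2 * i - 1}"
    by (rule Set.set_eqI) (use i in \<open>auto simp: S H_arc_def\<close>)
qed

lemma H_graph_vertex_cases:
  fixes j k :: nat
  assumes "j < 2 * k + 3"
  obtains "j = 0" | i where "i \<in> {1..k - 1}" "j = 2 * i - 1" | i where "i \<in> {1..k - 1}" "j = 2 * i"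
  | "j = 2 * k - 1" | "j = 2 * k" | "j = 2 * k + 1" | "j = 2 * k + 2"
proof -
  have "1 \<le> i \<and> i \<le> k - 1 \<and> (j = 2 * i - 1 \<or> j = 2 * i)"
    if "j \<noteq> 0" "j < 2 * k - 1" "i = (j + 1) div 2" for i
    using that by presburger
  moreover have "j < 2 * k - 1 \<or> j = 2 * k - 1 \<or> j = 2 * k \<or> j = 2 * k + 1 \<or> j = 2 * k + 2"
    using assms by linarith
  ultimately show ?thesis using that by (metis atLeastAtMost_iff)
qed

text \<open>The weights are solved outwards from 1 at the centre. A triangle vertex x satisfies
  (q-3)x = 1. On the 5-cycle, reflection symmetry gives both inner vertices one weight y and both
  outer ones (q-3)y, and (q-2)(q-3)y = 1 + y yields y = 1/D. The equation at the centre is then the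
  quartic.\<close>

lemma H_graph_eigenvector:
  fixes q :: real
  assumes k: "k \<ge> 6" and root: "quartic k q = 0" and q: "q > 2 * real k + 1"
  obtains x :: "nat \<Rightarrow> real" where
    "\<And>j. j < 2 * k + 3 \<Longrightarrow> x j > 0"
    "\<And>j. j < 2 * k + 3 \<Longrightarrow> real (card (H_nbrs k j)) * x j + (\<Sum>i\<in>H_nbrs k j. x i) = q * x j"
proof -
  have k1: "k \<ge> 1" using k by simp
  note S = H_nbrs_eq[OF k1]
  define D where "D = (q - 3) * (q - 2) - 1"
  have q3: "q > 13" using q k by simp
  have "1 < (q - 3) * (q - 2)" using q3 by (intro less_1_mult) auto
  then have D: "D > 0" by (simp add: D_def)
  define x :: "nat \<Rightarrow> real" where
    "x j = (if j = 0 then 1 else if j < 2 * k - 1 then 1 / (q - 3)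
      else if j = 2 * k - 1 \<or> j = 2 * k + 2 then (q - 3) / D else 1 / D)" for j
  have x0: "x 0 = 1" by (simp add: x_def)
  have xs: "x j = 1 / (q - 3)" if "1 \<le> j" "j < 2 * k - 1" for j using that by (simp add: x_def)
  have xp: "x (2 * k - 1) = (q - 3) / D" "x (2 * k + 2) = (q - 3) / D"
    "x (2 * k) = 1 / D" "x (2 * k + 1) = 1 / D"
    using k by (auto simp: x_def)
  have tri: "2 * (1 / (q - 3)) + (1 + 1 / (q - 3)) = q * (1 / (q - 3))"
  proof -
    have "(q - 3) * (1 / (q - 3)) = 1" using q3 by simp
    then show ?thesis by (simp only: left_diff_distrib)
  qed
  have pth: "2 * ((q - 3) / D) + (1 + 1 / D) = q * ((q - 3) / D)"
  proof -
    have "2 * ((q - 3) / D) + (1 + 1 / D) = (2 * (q - 3) + (D + 1)) / D"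
      using D by (simp only: add_divide_distrib times_divide_eq_right divide_self_if) simp
    also have "2 * (q - 3) + (D + 1) = q * (q - 3)" by (simp add: D_def algebra_simps)
    finally show ?thesis by simp
  qed
  have cyc: "2 * (1 / D) + ((q - 3) / D + 1 / D) = q * (1 / D)"
    by (simp add: add_divide_distrib[symmetric])
  have ctr: "2 * real k + ((2 * real k - 2) * (1 / (q - 3)) + (q - 3) / D + (q - 3) / D) = q"
  proof -
    \<comment> \<open>Multiplied by (q-3)D, the centre equation is ((q-2k)(q-3) - (2k-2)) D =
      2(q-3)^2, and the bracket factors as (q-2k-1)(q-2).\<close>
    have r: "(q - 2 * k - 1) * (q - 2) * D = 2 * (q - 3)\<^sup>2"
      using root by (simp add: quartic_def D_def)
    have "(q - 3) * D * (2 * real k + ((2 * real k - 2) * (1 / (q - 3)) + (q - 3) / D + (q - 3) / D))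
        = 2 * real k * (q - 3) * D + (2 * real k - 2) * D + 2 * (q - 3)\<^sup>2"
      using q3 D by (simp add: field_simps power2_eq_square)
    also have "\<dots> = (q - 3) * D * q" unfolding r[symmetric] by (simp add: algebra_simps)
    finally show ?thesis using q3 D by simp
  qed
  have eig: "real (card (H_nbrs k j)) * x j + (\<Sum>i\<in>H_nbrs k j. x i) = q * x j" if "j < 2 * k + 3" for j
    using that
  proof (cases rule: H_graph_vertex_cases)
    case 1
    have nb: "H_nbrs k 0 = insert (2 * k + 2) (insert (2 * k - 1) {1..<2 * k - 1})"
    proof -
      have "{1..2 * k - 1} = insert (2 * k - 1) {1..<2 * k - 1}"
        using ivl_disj_un_singleton(6)[of 1 "2 * k - 1"] k by simp
      then show ?thesis unfolding S(1) by simp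
    qed
    have sm: "(\<Sum>i\<in>{1..<2 * k - 1}. x i) = (2 * real k - 2) * (1 / (q - 3))"
    proof -
      have "(\<Sum>i\<in>{1..<2 * k - 1}. x i) = (\<Sum>i\<in>{1..<2 * k - 1}. 1 / (q - 3))"
        using xs by (intro sum.cong) auto
      then show ?thesis using k by (simp add: of_nat_diff)
    qed
    have "card (H_nbrs k 0) = 2 * k"
      "(\<Sum>i\<in>H_nbrs k 0. x i) = (q - 3) / D + ((q - 3) / D + (2 * real k - 2) * (1 / (q - 3)))"
    proof -
      have ne: "2 * k + 2 \<notin> insert (2 * k - 1) {1..<2 * k - 1}" "2 * k - 1 \<notin> {1..<2 * k - 1}"
        by auto
      have fin: "finite (insert (2 * k - 1) {1..<2 * k - 1})" "finite {1..<2 * k - 1}" by auto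
      show "card (H_nbrs k 0) = 2 * k"
        unfolding nb card_insert_disjoint[OF fin(1) ne(1)] card_insert_disjoint[OF fin(2) ne(2)]
        using k by simp
      show "(\<Sum>i\<in>H_nbrs k 0. x i) = (q - 3) / D + ((q - 3) / D + (2 * real k - 2) * (1 / (q - 3)))"
        unfolding nb sum.insert[OF fin(1) ne(1)] sum.insert[OF fin(2) ne(2)] xp sm ..
    qed
    then show ?thesis using ctr 1 x0 by simp
  next
    case (2 i)
    then have "card (H_nbrs k j) = 2" "(\<Sum>i\<in>H_nbrs k j. x i) = x 0 + x (2 * i)" "x (2 * i) = 1 / (q - 3)"
      "x j = 1 / (q - 3)"
      using S(2)[of i] xs by auto
    then show ?thesis using tri x0 by simp
  next
    case (3 i)
    then have "card (H_nbrs k j) = 2" "(\<Sum>i\<in>H_nbrs k j. x i) = x 0 + x (2 * i - 1)" "x (2 * i - 1) = 1 / (q - 3)"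
      "x j = 1 / (q - 3)"
      using S(3)[of i] xs[of "2 * i - 1"] xs[of "2 * i"] by auto
    then show ?thesis using tri x0 by simp
  next
    case 4
    then have "card (H_nbrs k j) = 2" "(\<Sum>i\<in>H_nbrs k j. x i) = x 0 + x (2 * k)" using S(4) k by auto
    then show ?thesis using pth x0 xp 4 by simp
  next
    case 5
    then have "card (H_nbrs k j) = 2" "(\<Sum>i\<in>H_nbrs k j. x i) = x (2 * k - 1) + x (2 * k + 1)" using S(5) k by auto
    then show ?thesis using cyc xp 5 by simp
  next
    case 6
    then have "card (H_nbrs k j) = 2" "(\<Sum>i\<in>H_nbrs k j. x i) = x (2 * k + 2) + x (2 * k)" using S(6) k by auto
    then show ?thesis using cyc xp 6 by simp
  next
    case 7
    then have "card (H_nbrs k j) = 2" "(\<Sum>i\<in>H_nbrs k j. x i) = x 0 + x (2 * k + 1)" using S(7) k by auto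
    then show ?thesis using pth x0 xp 7 by simp
  qed
  have pos: "x j > 0" for j using q3 D by (simp add: x_def)
  show ?thesis by (rule that[OF pos eig])
qed

lemma (in embedded_graph) q_radius_isomorphic_H_graph:
  assumes k: "k \<ge> 6" and iso: "isomorphic G (H_graph (2 * k - 1) 5)"
  shows "q_radius G = q_bound (3 * k + 2)"
proof -
  let ?H = "H_graph (2 * k - 1) 5"
  let ?q = "q_bound (3 * k + 2)"
  note r = q_bound_root_gt[OF k refl]
  obtain x where x: "\<And>j. j < 2 * k + 3 \<Longrightarrow> x j > 0"
    "\<And>j. j < 2 * k + 3 \<Longrightarrow> real (card (H_nbrs k j)) * x j + (\<Sum>i\<in>H_nbrs k j. x i) = ?q * x j"
    using H_graph_eigenvector[OF k r(1) less_trans[OF q_lower_gt r(2)]] by blast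
  obtain \<phi> where inj: "inj_on \<phi> (pverts G)" and verts: "pverts ?H = \<phi> ` pverts G"
    and arcs: "parcs ?H = map_prod \<phi> \<phi> ` parcs G"
    using iso isomorphic_iff[OF R_subset, of ?H] by blast
  have lt: "\<phi> v < 2 * k + 3" if "v \<in> pverts G" for v
    using that verts pverts_H_graph[of k] k by auto
  have nb: "H_nbrs k (\<phi> v) = \<phi> ` nbrs v" if v: "v \<in> pverts G" for v
  proof -
    have "(a, b) \<in> parcs G \<Longrightarrow> \<phi> a = \<phi> v \<Longrightarrow> a = v" for a b
      using inj_onD[OF inj, of a v] v R_subset by blast
    then show ?thesis unfolding H_nbrs_def arcs by force
  qed
  have inj_nb: "inj_on \<phi> (nbrs v)" for v using inj inj_on_subset nbrs_subset by blast
  show ?thesis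
  proof (rule q_radius_eq)
    show "pverts G \<noteq> {}" using verts pverts_H_graph[of k] k by force
    show "(x \<circ> \<phi>) v > 0" if "v \<in> pverts G" for v using x(1)[OF lt[OF that]] by simp
    show "Q_apply (x \<circ> \<phi>) v = ?q * (x \<circ> \<phi>) v" if "v \<in> pverts G" for v
      using x(2)[OF lt[OF that]]
      by (simp add: nb[OF that] card_image[OF inj_nb] sum.reindex[OF inj_nb] Q_apply_def)
  qed
qed

section \<open>The extremal structure\<close>

lemma parcs_H_graph_subset:
  assumes "k \<ge> 1"
  shows "parcs (H_graph (2 * k - 1) 5) \<subseteq> {..<2 * k + 3} \<times> {..<2 * k + 3}"
proof
  fix e assume e: "e \<in> parcs (H_graph (2 * k - 1) 5)"
  obtain a b where ab: "e = (a, b)" by (cases e)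
  have "H_arc k a b \<or> H_arc k b a" using e parcs_H_graph_iff[OF assms] ab by simp
  then have "a < 2 * k + 3 \<and> b < 2 * k + 3" unfolding H_arc_def by linarith
  then show "e \<in> {..<2 * k + 3} \<times> {..<2 * k + 3}" using ab by simp
qed

text \<open>A labelling onto as many vertices as there are labels is bijective, so agreement of
  neighbourhoods already gives an isomorphism.\<close>

lemma (in embedded_graph) isomorphic_H_graphI:
  assumes k: "k \<ge> 1" and f: "f ` {..<2 * k + 3} = pverts G" and card: "card (pverts G) = 2 * k + 3"
    and nb: "\<And>j. j < 2 * k + 3 \<Longrightarrow> nbrs (f j) = f ` H_nbrs k j"
  shows "isomorphic G (H_graph (2 * k - 1) 5)"
proof -
  let ?H = "H_graph (2 * k - 1) 5" and ?S = "{..<2 * k + 3}"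
  have inj: "inj_on f ?S" using f card by (intro eq_card_imp_inj_on) auto
  define \<phi> where "\<phi> = the_inv_into ?S f"
  have \<phi>: "\<phi> (f j) = j" if "j < 2 * k + 3" for j
    using the_inv_into_f_f[OF inj] that by (simp add: \<phi>_def)
  have "inj_on \<phi> (pverts G)" unfolding \<phi>_def using inj_on_the_inv_into[OF inj] f by simp
  moreover have "pverts ?H = \<phi> ` pverts G"
    using the_inv_into_onto[OF inj] f pverts_H_graph[OF k] by (simp add: \<phi>_def)
  moreover have "parcs ?H = map_prod \<phi> \<phi> ` parcs G"
  proof (intro subset_antisym subsetI)
    fix e assume e: "e \<in> parcs ?H"
    obtain a b where ab: "e = (a, b)" by (cases e)
    have lt: "a < 2 * k + 3" "b < 2 * k + 3" using parcs_H_graph_subset[OF k] e ab by auto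
    have "b \<in> H_nbrs k a" using e ab by (simp add: H_nbrs_def)
    then have "f b \<in> nbrs (f a)" using nb[OF lt(1)] by simp
    then have "map_prod \<phi> \<phi> (f a, f b) \<in> map_prod \<phi> \<phi> ` parcs G" by (intro imageI) simp
    then show "e \<in> map_prod \<phi> \<phi> ` parcs G" using \<phi> lt ab by simp
  next
    fix e assume "e \<in> map_prod \<phi> \<phi> ` parcs G"
    then obtain u w where uw: "(u, w) \<in> parcs G" "e = (\<phi> u, \<phi> w)" by auto
    then have "u \<in> f ` ?S" using R_subset f by auto
    then obtain a where a: "a < 2 * k + 3" "u = f a" by auto
    have "w \<in> f ` H_nbrs k a" using nb[OF a(1)] uw(1) a(2) by auto
    then obtain b where b: "(a, b) \<in> parcs ?H" "w = f b" by (auto simp: H_nbrs_def)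
    then have "b < 2 * k + 3" using parcs_H_graph_subset[OF k] by auto
    then show "e \<in> parcs ?H" using uw(2) a b \<phi> by simp
  qed
  ultimately show ?thesis using isomorphic_iff[OF R_subset] by blast
qed

context theta_free_graph
begin

text \<open>The two neighbours off the triangles each need a far neighbour, which uses up both cross
  edges, so triangle neighbours have none. Each of the two far vertices has at most one far
  neighbour and hence must also receive a cross edge; degree 2 then makes them adjacent and closes
  the 5-cycle \<open>v a c d b\<close>.\<close>

lemma extremal_structure:
  assumes v: "v \<in> V" "deg v = 2 * k" "card (triangle_nbrs v) = 2 * (k - 1)"
    and c: "cross v = 2" "card (far v) = 2"
  obtains a b c d where
    "nbrs v - triangle_nbrs v = {a, b}" "far v = {c, d}"
    "nbrs a = {v, c}" "nbrs b = {v, d}" "nbrs c = {a, d}" "nbrs d = {b, c}"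
    "\<forall>u\<in>triangle_nbrs v. nbrs u = {v} \<union> (nbrs u \<inter> nbrs v)"
proof -
  let ?S = "nbrs v - triangle_nbrs v"
  have T: "triangle_nbrs v \<subseteq> nbrs v" by (rule triangle_nbrs_subset)
  have cardS: "card ?S = 2" using card_Diff_subset[OF _ T] v k6 by simp
  have "2 = (\<Sum>u\<in>?S. 1::nat)" using cardS by simp
  also have "\<dots> \<le> (\<Sum>u\<in>?S. card (nbrs u \<inter> far v))" using cross_nontriangle by (intro sum_mono) auto
  finally have S2: "2 \<le> (\<Sum>u\<in>?S. card (nbrs u \<inter> far v))" .
  have "cross v = (\<Sum>u\<in>?S. card (nbrs u \<inter> far v)) + (\<Sum>u\<in>triangle_nbrs v. card (nbrs u \<inter> far v))"
    unfolding cross_def by (rule sum.subset_diff[OF T]) simp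
  then have "(\<Sum>u\<in>triangle_nbrs v. card (nbrs u \<inter> far v)) = 0" using S2 c(1) by linarith
  then have tri: "nbrs u \<inter> far v = {}" if "u \<in> triangle_nbrs v" for u using that by simp
  have split: "nbrs u = {v} \<union> (nbrs u \<inter> nbrs v) \<union> (nbrs u \<inter> far v)" if u: "u \<in> nbrs v" for u
  proof -
    have "(u, v) \<in> R" using u nbr_sym by blast
    then show ?thesis using nbrs_subset[of u] unfolding far_def by blast
  qed
  have one: "\<exists>w. nbrs u \<inter> far v = {w}" if "u \<in> ?S" for u
    using cross_one[OF tri _ that] c(1) v k6 by (simp add: card_1_singleton_iff)
  obtain a b where ab: "?S = {a, b}" "a \<noteq> b" using cardS by (auto simp: card_2_iff)
  then have abS: "a \<in> ?S" "b \<in> ?S" by blast+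
  obtain p where p: "nbrs a \<inter> far v = {p}" using one[OF abS(1)] by blast
  obtain q where q: "nbrs b \<inter> far v = {q}" using one[OF abS(2)] by blast
  have na: "nbrs a = {v, p}" using split[of a] abS(1) p nontriangle_nbrs[OF abS(1)] by auto
  have nb: "nbrs b = {v, q}" using split[of b] abS(2) q nontriangle_nbrs[OF abS(2)] by auto
  have far_nbrs: "nbrs w \<inter> nbrs v = {u \<in> {a, b}. w \<in> nbrs u}" if w: "w \<in> far v" for w
  proof (intro subset_antisym subsetI)
    fix u assume u: "u \<in> nbrs w \<inter> nbrs v"
    then have "w \<in> nbrs u" using nbr_sym by auto
    then have "u \<notin> triangle_nbrs v" using tri w by blast
    then have "u \<in> {a, b}" using u ab(1) by blast
    then show "u \<in> {u \<in> {a, b}. w \<in> nbrs u}" using \<open>w \<in> nbrs u\<close> by simp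
  next
    fix u assume "u \<in> {u \<in> {a, b}. w \<in> nbrs u}"
    then show "u \<in> nbrs w \<inter> nbrs v" using abS nbr_sym[of u w] by auto
  qed
  have pq_far: "p \<in> far v" "q \<in> far v" using p q by blast+
  have far1: "card (nbrs w \<inter> far v) \<le> 1" if w: "w \<in> far v" for w
  proof -
    have "nbrs w \<inter> far v \<subseteq> far v - {w}" using nbr_neq[of w w] by auto
    then have "card (nbrs w \<inter> far v) \<le> card (far v - {w})" by (intro card_mono) auto
    then show ?thesis using w c(2) by simp
  qed
  have touch: "w = p \<or> w = q" if w: "w \<in> far v" for w
  proof -
    have "nbrs w \<inter> nbrs v \<noteq> {}" using far_deg_ge[OF w] far1[OF w] by fastforce
    then obtain u where "u \<in> {a, b}" "w \<in> nbrs u" using far_nbrs[OF w] by blast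
    then show ?thesis using na nb w by (auto simp: far_def)
  qed
  then have far_eq: "far v = {p, q}" using pq_far by blast
  then have pq: "p \<noteq> q" using c(2) by auto
  have "p \<noteq> v" "q \<noteq> v" using pq_far by (auto simp: far_def)
  have vn: "v \<notin> nbrs p" "v \<notin> nbrs q" using pq_far nbr_sym[of p v] nbr_sym[of q v] by (auto simp: far_def)
  have cov: "nbrs w \<subseteq> (nbrs w \<inter> nbrs v) \<union> (nbrs w \<inter> far v)" if "v \<notin> nbrs w" for w
    using nbrs_subset[of w] that by (auto simp: far_def)
  have eq: "X = {x, y}" if "X \<subseteq> {x, y}" "2 \<le> card X" for X :: "'a set" and x y
    by (rule card_seteq[OF _ that(1)]) (use that(2) card_insert_le_m1[of 2 "{y}" x] in auto)
  have "nbrs p \<inter> nbrs v = {a}" using far_nbrs[OF pq_far(1)] na nb pq \<open>p \<noteq> v\<close> ab(2) by auto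
  moreover have "nbrs p \<inter> far v \<subseteq> {q}" using far_eq nbr_neq[of p p] by auto
  ultimately have "nbrs p \<subseteq> {a, q}" using cov[OF vn(1)] by blast
  then have np: "nbrs p = {a, q}" using min_deg[of p] pq_far by (intro eq) (auto simp: far_def)
  have "nbrs q \<inter> nbrs v = {b}" using far_nbrs[OF pq_far(2)] na nb pq \<open>q \<noteq> v\<close> ab(2) by auto
  moreover have "nbrs q \<inter> far v \<subseteq> {p}" using far_eq nbr_neq[of q q] by auto
  ultimately have "nbrs q \<subseteq> {b, p}" using cov[OF vn(2)] by blast
  then have nq: "nbrs q = {b, p}" using min_deg[of q] pq_far by (intro eq) (auto simp: far_def)
  have nt: "\<forall>u\<in>triangle_nbrs v. nbrs u = {v} \<union> (nbrs u \<inter> nbrs v)"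
  proof
    fix u assume "u \<in> triangle_nbrs v"
    then show "nbrs u = {v} \<union> (nbrs u \<inter> nbrs v)" using split[of u] T tri[of u] by blast
  qed
  show ?thesis by (rule that[OF ab(1) far_eq na nb np nq nt])
qed

lemma extremal_enumeration:
  assumes v: "v \<in> V" "deg v = 2 * k" "card (triangle_nbrs v) = 2 * (k - 1)"
    and c: "cross v = 2" "card (far v) = 2"
  shows "card V = 2 * k + 3"
    and "\<exists>f. f ` {..<2 * k + 3} = V \<and> (\<forall>j<2 * k + 3. nbrs (f j) = f ` H_nbrs k j)"
proof -
  have vN: "v \<notin> nbrs v" using nbr_neq[of v v] by auto
  have V: "V = insert v (nbrs v \<union> far v)" using v(1) nbrs_subset by (auto simp: far_def)
  have "card (nbrs v \<union> far v) = 2 * k + 2" using v(2) c(2)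
    by (subst card_Un_disjoint) (auto simp: far_def finite_V)
  moreover have "v \<notin> nbrs v \<union> far v" using vN by (simp add: far_def)
  ultimately have "card (insert v (nbrs v \<union> far v)) = 2 * k + 3" by simp
  then show "card V = 2 * k + 3" using V by simp
  obtain a b p q where S: "nbrs v - triangle_nbrs v = {a, b}" and far: "far v = {p, q}"
    and nb: "nbrs a = {v, p}" "nbrs b = {v, q}" "nbrs p = {a, q}" "nbrs q = {b, p}"
    and nt: "\<forall>u\<in>triangle_nbrs v. nbrs u = {v} \<union> (nbrs u \<inter> nbrs v)"
    by (rule extremal_structure[OF v c])
  have N: "nbrs v = triangle_nbrs v \<union> {a, b}" using S triangle_nbrs_subset by blast
  \<comment> \<open>The third vertex of the triangle through \<open>v\<close> and \<open>u\<close>: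
    an involution without fixed points on the triangle neighbours.\<close>
  define \<sigma> where "\<sigma> u = the_elem (nbrs u \<inter> nbrs v)" for u
  have \<sigma>: "nbrs u \<inter> nbrs v = {\<sigma> u}" "\<sigma> u \<in> triangle_nbrs v" if "u \<in> triangle_nbrs v" for u
    using triangle_partner[OF that] by (metis \<sigma>_def the_elem_eq)+
  have nt': "nbrs u = {v, \<sigma> u}" if "u \<in> triangle_nbrs v" for u using bspec[OF nt that] \<sigma>(1)[OF that] by (simp add: insert_commute)
  have inv: "\<sigma> (\<sigma> u) = u" if "u \<in> triangle_nbrs v" for u
  proof -
    have "u \<in> nbrs (\<sigma> u) \<inter> nbrs v" using nt'[OF that] nbr_sym[of u "\<sigma> u"] that triangle_nbrs_subset by blast
    then show ?thesis using \<sigma>(1)[OF \<sigma>(2)[OF that]] by auto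
  qed
  have ne: "\<sigma> u \<noteq> u" if "u \<in> triangle_nbrs v" for u
  proof -
    have "\<sigma> u \<in> nbrs u \<inter> nbrs v" unfolding \<sigma>(1)[OF that] by (rule singletonI)
    then show ?thesis using nbr_neq[of u "\<sigma> u"] by simp
  qed
  obtain g where g: "g ` {1..2 * (k - 1)} = triangle_nbrs v"
    "\<forall>i\<in>{1..k - 1}. g (2 * i) = \<sigma> (g (2 * i - 1))"
    using pairing_enumeration[of "triangle_nbrs v" "k - 1" \<sigma>, OF finite_triangle_nbrs v(3)] \<sigma>(2) inv ne
    by metis
  \<comment> \<open>The order \<open>a\<close>, \<open>p\<close>, \<open>q\<close>, \<open>b\<close>
    runs along the 5-cycle, matching the labels 2k-1 to 2k+2.\<close>
  define f where "f j = (if j = 0 then v else if j < 2 * k - 1 then g j else if j = 2 * k - 1 then a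
    else if j = 2 * k then p else if j = 2 * k + 1 then q else b)" for j
  have fT: "f j = g j" if "1 \<le> j" "j < 2 * k - 1" for j
    using that by (auto simp: f_def)
  have f0: "f 0 = v" by (simp add: f_def)
  have fp: "f (2 * k - 1) = a" "f (2 * k) = p" "f (2 * k + 1) = q" "f (2 * k + 2) = b"
    using k6 by (auto simp: f_def)
  have fg: "f ` {1..2 * (k - 1)} = triangle_nbrs v"
  proof -
    have "f ` {1..2 * (k - 1)} = g ` {1..2 * (k - 1)}" using k6 fT by (intro image_cong) auto
    then show ?thesis using g(1) by simp
  qed
  have f0N: "f ` ({1..2 * k - 1} \<union> {2 * k + 2}) = nbrs v"
  proof -
    have "{1..2 * k - 1} \<union> {2 * k + 2} = {1..2 * (k - 1)} \<union> {2 * k - 1, 2 * k + 2}" using k6 by auto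
    then have "f ` ({1..2 * k - 1} \<union> {2 * k + 2}) = f ` {1..2 * (k - 1)} \<union> {f (2 * k - 1), f (2 * k + 2)}"
      by (simp only: image_Un image_insert image_empty)
    then show ?thesis unfolding fg fp N .
  qed
  have k1: "k \<ge> 1" using k6 by simp
  note H = H_nbrs_eq[OF k1]
  have "f ` {..<2 * k + 3} = V"
  proof -
    have "{..<2 * k + 3} = {0} \<union> ({1..2 * k - 1} \<union> {2 * k + 2}) \<union> {2 * k, 2 * k + 1}" using k6 by auto
    then have "f ` {..<2 * k + 3} = {f 0} \<union> f ` ({1..2 * k - 1} \<union> {2 * k + 2}) \<union> {f (2 * k), f (2 * k + 1)}"
      by (simp only: image_Un image_insert image_empty)
    moreover have "V = insert v (nbrs v \<union> {p, q})" using V unfolding far .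
    ultimately show ?thesis unfolding f0N f0 fp by blast
  qed
  moreover have "nbrs (f j) = f ` H_nbrs k j" if "j < 2 * k + 3" for j
    using that
  proof (cases rule: H_graph_vertex_cases)
    case 1
    then show ?thesis using f0N H(1) f0 by simp
  next
    case (2 i)
    then have i: "f (2 * i - 1) = g (2 * i - 1)" "f (2 * i) = g (2 * i)" "2 * i - 1 \<in> {1..2 * (k - 1)}"
      using fT[of "2 * i - 1"] fT[of "2 * i"] by auto
    then have "g (2 * i - 1) \<in> triangle_nbrs v" using g(1) by blast
    then show ?thesis using 2 H(2)[OF 2(1)] nt' g(2) i f0 by simp
  next
    case (3 i)
    then have i: "f (2 * i - 1) = g (2 * i - 1)" "f (2 * i) = g (2 * i)"
      "2 * i - 1 \<in> {1..2 * (k - 1)}" "2 * i \<in> {1..2 * (k - 1)}"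
      using fT[of "2 * i - 1"] fT[of "2 * i"] by auto
    then have mem: "g (2 * i - 1) \<in> triangle_nbrs v" "g (2 * i) \<in> triangle_nbrs v" using g(1) by blast+
    then have "nbrs (g (2 * i)) = {v, g (2 * i - 1)}" using nt'[OF mem(2)] g(2) 3(1) inv by simp
    then show ?thesis using 3 H(3)[OF 3(1)] i f0 by simp
  next
    case 4
    show ?thesis unfolding 4 H(4) fp using nb fp f0 by simp
  next
    case 5
    show ?thesis unfolding 5 H(5) fp using nb fp f0 by simp
  next
    case 6
    show ?thesis unfolding 6 H(6) fp using nb fp f0 by (simp add: insert_commute)
  next
    case 7
    show ?thesis unfolding 7 H(7) fp using nb fp f0 by (simp add: insert_commute)
  qed
  ultimately show "\<exists>f. f ` {..<2 * k + 3} = V \<and> (\<forall>j<2 * k + 3. nbrs (f j) = f ` H_nbrs k j)"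
    by blast
qed

end

text \<open>Connectedness rules out isolated vertices; together with the absence of pendant vertices
  this gives minimum degree 2.\<close>

lemma connected_deg_pos:
  assumes G: "pair_graph G" and conn: "is_connected G" and arcs: "parcs G \<noteq> {}"
    and v: "v \<in> pverts G"
  shows "parcs G `` {v} \<noteq> {}"
proof -
  interpret G: pair_graph G by (rule G)
  interpret simple_graph "pverts G" "parcs G" by (rule simple_graph_pair_graph[OF G])
  obtain a b where ab: "(a, b) \<in> parcs G" using arcs by auto
  obtain w where w: "w \<in> pverts G" "w \<noteq> v"
  proof (cases "a = v")
    case True
    then show ?thesis using that[of b] ab nbr_neq[OF ab] R_subset by auto
  next
    case False
    then show ?thesis using that[of a] ab R_subset by auto
  qed
  have sym: "(parcs G)\<^sup>s = parcs G" using sym_R by (auto simp: symcl_def sym_def)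
  have "(w, v) \<in> rtrancl_on (pverts G) (parcs G)"
    using conn w(1) v unfolding is_connected_def connected_conv by (simp add: sym)
  then obtain u where "(u, v) \<in> parcs G" using w(2) by (cases rule: rtrancl_on.cases) auto
  then show ?thesis using nbr_sym by blast
qed

theorem theorem4p2:
  fixes G :: "'a pair_pre_digraph" and k m :: nat
  assumes "k \<ge> 6" and "m = 3 * k + 2"
    and "pair_graph G" and "is_connected G"
    and "family_free {theta_graph [1, 2, 2], theta_graph [1, 2, 3]} G"
    and "size_of G = m"
    and "\<forall>v\<in>pverts G. \<not> pendant G v"
  shows "q_radius G \<le> q_bound m \<and>
         (q_radius G = q_bound m \<longleftrightarrow> isomorphic G (H_graph ((2 * m - 7) div 3) 5))"
proof -
  \<comment> \<open>The division is exact: 2m - 7 = 6k - 3.\<close>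
  have p: "(2 * m - 7) div 3 = 2 * k - 1" using assms(1,2) by auto
  have sg: "simple_graph (pverts G) (parcs G)" by (rule simple_graph_pair_graph[OF assms(3)])
  interpret embedded_graph G using sg by (simp add: embedded_graph_def)
  have size: "card {{u, v} | u v. (u, v) \<in> parcs G} = 3 * k + 2"
    using assms(2,6) by (simp add: size_of_def edges_def)
  then have ne: "parcs G \<noteq> {}" by auto
  then have ne': "pverts G \<noteq> {}" using R_subset by auto
  have free: "\<not> contains G (theta_graph [1, 2, 2])" "\<not> contains G (theta_graph [1, 2, 3])"
    using assms(5) by (auto simp: family_free_def)
  interpret theta_free_graph "pverts G" "parcs G" k
  proof
    show "6 \<le> k" by (rule assms(1))
    show "card {{u, v} | u v. (u, v) \<in> parcs G} = 3 * k + 2" by (rule size)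
    show "2 \<le> deg v" if "v \<in> pverts G" for v
    proof -
      have "deg v \<noteq> 0" using connected_deg_pos[OF assms(3,4) ne that] by simp
      moreover have "deg v \<noteq> 1" using assms(7) that by (auto simp: pendant_def degree_of_eq)
      ultimately show ?thesis by linarith
    qed
    show "c = d" if "(a, b) \<in> parcs G" "(a, c) \<in> parcs G" "(c, b) \<in> parcs G"
      "(a, d) \<in> parcs G" "(d, b) \<in> parcs G" for a b c d
      using contains_theta_122[OF sg that] free(1) by blast
    show False if "(a, b) \<in> parcs G" "(a, c) \<in> parcs G" "(c, b) \<in> parcs G"
      "(a, d) \<in> parcs G" "(d, e) \<in> parcs G" "(e, b) \<in> parcs G"
      "d \<noteq> b" "d \<noteq> c" "e \<noteq> a" "e \<noteq> c" for a b c d e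
      using contains_theta_123[OF sg that] free(2) by blast
  qed
  have iso_eq: "q_radius G = q_bound m" if "isomorphic G (H_graph (2 * k - 1) 5)"
    using q_radius_isomorphic_H_graph[OF assms(1) that] assms(2) by simp
  show ?thesis
  proof (cases "\<exists>v\<in>pverts G. deg v = 2 * k \<and> card (triangle_nbrs v) = 2 * (k - 1)
      \<and> cross v = 2 \<and> inner v = 1 \<and> card (far v) = 2")
    case True
    then obtain v where v: "v \<in> pverts G" "deg v = 2 * k" "card (triangle_nbrs v) = 2 * (k - 1)"
      "cross v = 2" "card (far v) = 2" by blast
    obtain f where "f ` {..<2 * k + 3} = pverts G" "\<forall>j<2 * k + 3. nbrs (f j) = f ` H_nbrs k j"
      using extremal_enumeration(2)[OF v] by blast
    then have "isomorphic G (H_graph (2 * k - 1) 5)"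
      using assms(1) extremal_enumeration(1)[OF v] by (intro isomorphic_H_graphI[of k f]) auto
    then show ?thesis using iso_eq p by simp
  next
    case False
    then obtain x where x: "\<forall>u\<in>pverts G. x u > 0 \<and> Q_apply x u < q_lower k * x u"
      using strict_weight by blast
    have "q_radius G < q_lower k" by (rule q_radius_less[of x, OF ne']) (use x in auto)
    \<comment> \<open>Strictness makes both sides of the equivalence false, since an isomorphism
      would give equality by \<open>iso_eq\<close>.\<close>
    then have "q_radius G < q_bound m" using q_bound_root_gt(2)[OF assms(1,2)] by simp
    then show ?thesis using iso_eq p by auto
  qed
qed

end
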